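(* For every $x_0\in\mathrm{int}(P)$ there exists $q=q(x_0)\in(0,1)$ such that the iterates $(x_k)_{k\ge 0}$ generated by the polarity process started at $x_0$ satisfy $$\delta_v(x_{k+1})\le q\,\delta_v(x_k),\qquad k\ge 0.$$ Consequently, the following hold. 1. (Asymptotic convergence) For any $x_0\in\mathrm{int}(P)$, we have $x_k\to x^*$ and $$E_{k+1}=(1-\tau(x_k))\bigl(Q(x_k)^{-1}-c(x_k)c(x_k)^\top\bigr)\to Q(x^* )^{-1},$$ where $\mathcal E(x^*,Q(x^* )^{-1})=\mathrm{MaxIE}(P)$. 2. (Iteration complexity on volume ratio) Let $\gamma\in(0,1)$ and $$N_\gamma^{\mathrm{ex}}=\left\lceil\frac{\log^+\bigl(\delta_v(x_0)/\log(1/\gamma)\bigr)}{\log(1/q)}\right\rceil.$$ Within $N_\gamma^{\mathrm{ex}}+1$ iterations the polarity process produces a $\gamma$-maximal ellipsoid of $P$: $$\frac{\mathrm{Vol}(\mathcal E_{N_\gamma^{\mathrm{ex}}+1})}{\mathrm{Vol}(\mathrm{MaxIE}(P))}\ge\gamma.$$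
   Context: $P=\{x\in\mathbb R^n: a_i^\top x\le 1,\ i=1,\dots,m\}$ is a full-dimensional (bounded) polytope. For $c\in\mathbb R^n$ and $Q$ symmetric positive definite, $\mathcal E(c,Q)=\{y\in\mathbb R^n:(y-c)^\top Q(y-c)\le 1\}$, with normalized volume $\mathrm{Vol}(\mathcal E(c,Q))=\det(Q)^{-1/2}$. The polar of a set $S$ is $S^\circ=\{y: y^\top s\le 1\ \forall s\in S\}$. $\mathrm{MinCE}(K)$ is the unique minimum-volume ellipsoid containing a full-dimensional compact set $K$; $\mathrm{MaxIE}(P)$ is the unique maximum-volume ellipsoid contained in $P$, and $x^*$ is its center. An ellipsoid $\mathcal E\subseteq P$ is $\gamma$-maximal if $\mathrm{Vol}(\mathcal E)\ge\gamma\,\mathrm{Vol}(\mathrm{MaxIE}(P))$. For $x\in\mathrm{int}(P)$ write $\mathrm{MinCE}((P-x)^\circ)=\mathcal E(c(x),Q(x))$, $\tau(x)=c(x)^\top Q(x)c(x)$, $v(x)=\log\mathrm{Vol}(\mathrm{MinCE}((P-x)^\circ))$, and $\delta_v(x)=v(x)-v(x^* )$. Polarity process: given $x_0\in\mathrm{int}(P)$, for $k=0,1,2,\dots$ compute $\mathrm{MinCE}((P-x_k)^\circ)=\mathcal E(c(x_k),Q(x_k))$, take its polar (about the origin) and write it as $\mathcal E(x'_{k+1},E'_{k+1})$, then set $x_{k+1}=x_k+x'_{k+1}$, $E_{k+1}=E'_{k+1}$ and $\mathcal E_{k+1}=\mathcal E(x_{k+1},E_{k+1})$. For $t>0$, $\log^+(t)=\max\{0,\log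 t\}$, and $\log^+(0)=0$. *)

theory Defs
  imports "HOL-Analysis.Analysis"
begin

definition pos_def :: "real^'n^'n \<Rightarrow> bool" where
  "pos_def Q \<longleftrightarrow> transpose Q = Q \<and> (\<forall>y. y \<noteq> 0 \<longrightarrow> y \<bullet> (Q *v y) > 0)"

definition outer :: "real^'n \<Rightarrow> real^'n^'n" where
  "outer c = (\<chi> i j. c $ i * c $ j)"

definition ellipsoid :: "real^'n \<Rightarrow> real^'n^'n \<Rightarrow> (real^'n) set" where
  "ellipsoid c Q = {y. (y - c) \<bullet> (Q *v (y - c)) \<le> 1}"

definition is_ellipsoid :: "(real^'n) set \<Rightarrow> bool" where
  "is_ellipsoid S \<longleftrightarrow> (\<exists>c Q. pos_def Q \<and> S = ellipsoid c Q)"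

text \<open>For an ellipsoid \<open>S\<close>, the unique pair \<open>(c, Q)\<close> with \<open>Q\<close> symmetric positive definite
  and \<open>S = ellipsoid c Q\<close>.  The value is unspecified if \<open>S\<close> is not an ellipsoid.\<close>

definition ellipsoid_params :: "(real^'n) set \<Rightarrow> (real^'n) \<times> (real^'n^'n)" where
  "ellipsoid_params S = (THE p. pos_def (snd p) \<and> S = ellipsoid (fst p) (snd p))"

definition center :: "(real^'n) set \<Rightarrow> real^'n" where
  "center S = fst (ellipsoid_params S)"

definition shape :: "(real^'n) set \<Rightarrow> real^'n^'n" where
  "shape S = snd (ellipsoid_params S)"

text \<open>Normalized volume: Lebesgue measure divided by that of the unit ball.\<close>

definition Vol :: "(real^'n) set \<Rightarrow> real" where
  "Vol S = det (shape S) powr (-1/2)"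

definition polar_set :: "(real^'n) set \<Rightarrow> (real^'n) set" where
  "polar_set S = {y. \<forall>s\<in>S. y \<bullet> s \<le> 1}"

definition MinCE :: "(real^'n) set \<Rightarrow> (real^'n) set" where
  "MinCE K = (THE S. is_ellipsoid S \<and> K \<subseteq> S \<and>
     (\<forall>S'. is_ellipsoid S' \<and> K \<subseteq> S' \<longrightarrow> Vol S \<le> Vol S'))"

definition MaxIE :: "(real^'n) set \<Rightarrow> (real^'n) set" where
  "MaxIE P = (THE S. is_ellipsoid S \<and> S \<subseteq> P \<and>
     (\<forall>S'. is_ellipsoid S' \<and> S' \<subseteq> P \<longrightarrow> Vol S' \<le> Vol S))"

definition gamma_maximal :: "(real^'n) set \<Rightarrow> real \<Rightarrow> (real^'n) set \<Rightarrow> bool" where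
  "gamma_maximal P \<gamma> S \<longleftrightarrow> is_ellipsoid S \<and> S \<subseteq> P \<and> Vol S \<ge> \<gamma> * Vol (MaxIE P)"

definition halfspace_polyhedron :: "nat \<Rightarrow> (nat \<Rightarrow> real^'n) \<Rightarrow> (real^'n) set" where
  "halfspace_polyhedron m a = {x. \<forall>i\<in>{1..m}. a i \<bullet> x \<le> 1}"

text \<open>The quantities \<open>x\<^sup>*\<close>, \<open>MinCE ((P - x)\<degree>)\<close>, \<open>c(x)\<close>, \<open>Q(x)\<close>, \<open>\<tau>(x)\<close>, \<open>v(x)\<close>, \<open>\<delta>\<^sub>v(x)\<close>;
  those depending on a point are meaningful for points in the interior of \<open>P\<close>.\<close>

definition xstar :: "(real^'n) set \<Rightarrow> real^'n" where
  "xstar P = center (MaxIE P)"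

definition polar_MinCE :: "(real^'n) set \<Rightarrow> real^'n \<Rightarrow> (real^'n) set" where
  "polar_MinCE P x = MinCE (polar_set ((\<lambda>p. p - x) ` P))"

definition cvec :: "(real^'n) set \<Rightarrow> real^'n \<Rightarrow> real^'n" where
  "cvec P x = center (polar_MinCE P x)"

definition Qmat :: "(real^'n) set \<Rightarrow> real^'n \<Rightarrow> real^'n^'n" where
  "Qmat P x = shape (polar_MinCE P x)"

definition tau :: "(real^'n) set \<Rightarrow> real^'n \<Rightarrow> real" where
  "tau P x = cvec P x \<bullet> (Qmat P x *v cvec P x)"

definition vfun :: "(real^'n) set \<Rightarrow> real^'n \<Rightarrow> real" where
  "vfun P x = ln (Vol (polar_MinCE P x))"

definition delta_v :: "(real^'n) set \<Rightarrow> real^'n \<Rightarrow> real" where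
  "delta_v P x = vfun P x - vfun P (xstar P)"

text \<open>The polarity process.  The matrix iterates \<open>E\<^sub>k\<close> and the ellipsoids \<open>\<E>\<^sub>k\<close> are only
  defined for \<open>k \<ge> 1\<close>.\<close>

primrec proc_x :: "(real^'n) set \<Rightarrow> real^'n \<Rightarrow> nat \<Rightarrow> real^'n" where
  "proc_x P x0 0 = x0"
| "proc_x P x0 (Suc k) =
     proc_x P x0 k + center (polar_set (polar_MinCE P (proc_x P x0 k)))"

primrec (nonexhaustive) proc_E :: "(real^'n) set \<Rightarrow> real^'n \<Rightarrow> nat \<Rightarrow> real^'n^'n" where
  "proc_E P x0 (Suc k) = shape (polar_set (polar_MinCE P (proc_x P x0 k)))"

definition proc_ell :: "(real^'n) set \<Rightarrow> real^'n \<Rightarrow> nat \<Rightarrow> (real^'n) set" where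
  "proc_ell P x0 k = ellipsoid (proc_x P x0 k) (proc_E P x0 k)"

definition log_plus :: "real \<Rightarrow> real" where
  "log_plus t = (if t > 0 then max 0 (ln t) else 0)"

definition N_ex :: "(real^'n) set \<Rightarrow> real^'n \<Rightarrow> real \<Rightarrow> real \<Rightarrow> nat" where
  "N_ex P x0 q \<gamma> = nat \<lceil>log_plus (delta_v P x0 / ln (1 / \<gamma>)) / ln (1 / q)\<rceil>"

end

theory Submission
  imports Defs
begin

text \<open>
  Write \<open>b\<^sub>i = a\<^sub>i / (1 - a\<^sub>i \<bullet> x)\<close>. An ellipsoid contains the polar of \<open>P - x\<close> iff it contains
  all the \<open>b\<^sub>i\<close>, and maximising the determinant of the covariance of a probability weight \<open>\<lambda>\<close> on
  the \<open>b\<^sub>i\<close> produces the minimum-volume ellipsoid \<open>\<E>(c, Q)\<close> together with John weights \<open>\<lambda>\<close>.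

  The polar of \<open>\<E>(c, Q)\<close> is an ellipsoid inside \<open>P - x\<close> whose log-volume is
  \<open>- v(x) - (n+1)/2 log(1 - \<tau>(x))\<close>; taking polars about its centre gives the descent
  \<open>v(x\<^sub>+) \<le> v(x) - (n+1)/2 \<tau>(x)\<close> and shows that \<open>v\<close> is minimal exactly at \<open>x\<^sup>*\<close>, with \<open>c(x\<^sup>*) = 0\<close>.

  Conversely \<open>v(x) - v(x\<^sup>*) \<le> (n+1) \<Sum>\<^sub>i \<lambda>\<^sub>i log(1 - b\<^sub>i \<bullet> (x\<^sup>* - x))\<close>, by Jensen's inequality for the lifted
  vectors \<open>(b\<^sub>i, 1)\<close>. Expanding the logarithm to second order, the linear term is \<open>- c \<bullet> (x\<^sup>* - x)\<close> and
  the quadratic one dominates \<open>(x\<^sup>* - x) \<bullet> Q\<^sup>-\<^sup>1 (x\<^sup>* - x)\<close>, so \<open>\<delta>\<^sub>v(x) \<le> n(n+1)R/2 \<tau>(x)\<close>, where \<open>R\<close> bounds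
  the ratios of the slacks at \<open>x\<^sup>*\<close> and \<open>x\<close>. Along the process \<open>R\<close> is uniform, because the iterates
  are centres of inscribed ellipsoids of volume bounded below; hence \<open>q = 1 - 1/(nR)\<close>. Convergence
  of the ellipsoids follows from compactness and the uniqueness of the maximal one.
\<close>

section \<open>Symmetric matrices\<close>

definition diag_mat :: "('n \<Rightarrow> real) \<Rightarrow> real^'n^'n" where
  "diag_mat \<sigma> = (\<chi> i j. if i = j then \<sigma> i else 0)"

lemma symmetric_inner:
  fixes A :: "real^'n^'n"
  assumes "transpose A = A"
  shows "(A *v x) \<bullet> y = x \<bullet> (A *v y)"
  by (metis assms dot_lmul_matrix transpose_matrix_vector)

lemma trace_diag_mat: "trace (diag_mat \<sigma>) = (\<Sum>k\<in>UNIV. \<sigma> k)"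
  by (simp add: trace_def diag_mat_def)

lemma det_diag_mat: "det (diag_mat \<sigma>) = (\<Prod>k\<in>UNIV. \<sigma> k)"
  by (subst det_diagonal) (auto simp: diag_mat_def)

lemma diag_mat_matrix_mult: "diag_mat \<sigma> ** diag_mat \<tau> = diag_mat (\<lambda>k. \<sigma> k * \<tau> k)"
  by (simp add: diag_mat_def matrix_matrix_mult_def vec_eq_iff if_distrib [where f="\<lambda>x. x * _"] cong: if_cong)

lemma transpose_diag_mat: "transpose (diag_mat \<sigma>) = diag_mat \<sigma>"
  by (simp add: diag_mat_def transpose_def vec_eq_iff)

lemma diag_mat_vector: "diag_mat \<sigma> *v x = (\<chi> k. \<sigma> k * x $ k)"
  by (simp add: diag_mat_def matrix_vector_mult_def vec_eq_iff if_distrib [where f="\<lambda>x. x * _"] cong: if_cong)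

text \<open>A maximiser of the Rayleigh quotient over the unit sphere of the orthogonal complement
  of \<open>B\<close> is an eigenvector: \<open>A\<close> maps that complement into itself because
  \<open>B\<close> consists of eigenvectors, so the residual at the maximiser is an admissible
  direction of variation. The vector \<open>z\<close> only certifies that the complement is
  nontrivial.\<close>

lemma symmetric_eigenvector_complement:
  fixes A :: "real^'n^'n"
  assumes sym: "transpose A = A"
    and B: "\<And>b. b \<in> B \<Longrightarrow> \<exists>\<mu>. A *v b = \<mu> *\<^sub>R b"
    and z: "z \<noteq> 0" "\<And>b. b \<in> B \<Longrightarrow> b \<bullet> z = 0"
  obtains x \<mu> where "norm x = 1" "A *v x = \<mu> *\<^sub>R x" "\<And>b. b \<in> B \<Longrightarrow> b \<bullet> x = 0"
proof -
  define W where "W = {w. \<forall>b\<in>B. b \<bullet> w = 0}"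
  have "W = (\<Inter>b\<in>B. {w. b \<bullet> w = 0})"
    by (auto simp: W_def)
  then have "closed W"
    by (auto intro!: closed_INT closed_hyperplane)
  then have "compact (W \<inter> sphere 0 1)"
    by (intro closed_Int_compact) auto
  moreover have "(1 / norm z) *\<^sub>R z \<in> W \<inter> sphere 0 1"
    using z by (auto simp: W_def)
  moreover have "continuous_on (W \<inter> sphere 0 1) (\<lambda>x. x \<bullet> (A *v x))"
    by (intro continuous_intros linear_continuous_on matrix_vector_mul_bounded_linear)
  ultimately obtain x where x: "x \<in> W \<inter> sphere 0 1"
    and xmax: "\<And>y. y \<in> W \<inter> sphere 0 1 \<Longrightarrow> y \<bullet> (A *v y) \<le> x \<bullet> (A *v x)"
    using continuous_attains_sup [of "W \<inter> sphere 0 1"] by blast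
  define \<mu> where "\<mu> = x \<bullet> (A *v x)"
  have ray: "y \<bullet> (A *v y) \<le> \<mu> * (y \<bullet> y)" if "y \<in> W" for y
  proof (cases "y = 0")
    case False
    have "(1 / norm y) *\<^sub>R y \<in> W \<inter> sphere 0 1"
      using that False by (auto simp: W_def)
    then have "((1 / norm y) *\<^sub>R y) \<bullet> (A *v ((1 / norm y) *\<^sub>R y)) \<le> \<mu>"
      using xmax unfolding \<mu>_def by blast
    then have "(y \<bullet> (A *v y)) / (norm y)\<^sup>2 \<le> \<mu>"
      by (simp add: matrix_vector_mult_scaleR power2_eq_square)
    then show ?thesis
      using False by (simp add: divide_le_eq power2_norm_eq_inner mult.commute)
  qed simp
  define p where "p = A *v x - \<mu> *\<^sub>R x"
  have xx: "x \<bullet> x = 1"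
    using x by (simp add: norm_eq_sqrt_inner)
  have "b \<bullet> p = 0" if b: "b \<in> B" for b
  proof -
    obtain \<nu> where "A *v b = \<nu> *\<^sub>R b" using B b by blast
    then have "b \<bullet> (A *v x) = \<nu> * (b \<bullet> x)"
      by (metis inner_scaleR_left sym symmetric_inner)
    then show ?thesis using x b by (simp add: p_def W_def inner_diff_right)
  qed
  then have pW: "x + t *\<^sub>R p \<in> W" for t
    using x by (auto simp: W_def inner_add_right)
  \<comment> \<open>Inserting \<open>x + t p\<close> into the Rayleigh inequality, the first-order
    gain is \<open>2 * (p \<bullet> p)\<close> and \<open>C\<close> collects the second-order
    loss.\<close>
  define C where "C = \<mu> * (p \<bullet> p) - p \<bullet> (A *v p)"
  have le: "2 * (p \<bullet> p) \<le> t * C" if "t > 0" for t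
  proof -
    have pA: "p \<bullet> (A *v x) = x \<bullet> (A *v p)"
      by (metis inner_commute sym symmetric_inner)
    have pp: "p \<bullet> p = p \<bullet> (A *v x) - \<mu> * (x \<bullet> p)"
      by (subst (2) p_def) (simp add: inner_diff_right inner_commute)
    have "(x + t *\<^sub>R p) \<bullet> (A *v (x + t *\<^sub>R p)) \<le> \<mu> * ((x + t *\<^sub>R p) \<bullet> (x + t *\<^sub>R p))"
      by (rule ray [OF pW])
    then have "\<mu> + 2 * t * (p \<bullet> (A *v x)) + t * t * (p \<bullet> (A *v p))
        \<le> \<mu> * (1 + 2 * t * (x \<bullet> p) + t * t * (p \<bullet> p))"
      by (simp add: matrix_vector_right_distrib matrix_vector_mult_scaleR inner_add_left
          inner_add_right xx pA inner_commute [of p x] \<mu>_def [symmetric] algebra_simps)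
    then have "t * (2 * (p \<bullet> p)) \<le> t * (t * C)"
      by (simp add: pp C_def algebra_simps)
    then show ?thesis using that by simp
  qed
  have "p \<bullet> p \<le> 0"
  proof (rule ccontr)
    assume "\<not> p \<bullet> p \<le> 0"
    then have pos: "p \<bullet> p > 0" by linarith
    \<comment> \<open>A step this small keeps \<open>t * C\<close> below
      \<open>p \<bullet> p\<close>, hence below \<open>2 * (p \<bullet> p)\<close>; the added 1
      covers \<open>C = 0\<close>.\<close>
    have "(p \<bullet> p / (\<bar>C\<bar> + 1)) * C \<le> (p \<bullet> p / (\<bar>C\<bar> + 1)) * (\<bar>C\<bar> + 1)"
      using pos by (intro mult_left_mono) auto
    also have "\<dots> = p \<bullet> p"
    proof -
      have "\<bar>C\<bar> + 1 \<noteq> 0" by linarith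
      then show ?thesis by simp
    qed
    finally have "(p \<bullet> p / (\<bar>C\<bar> + 1)) * C \<le> p \<bullet> p" .
    moreover have "0 < p \<bullet> p / (\<bar>C\<bar> + 1)" using pos by simp
    ultimately show False using le [of "p \<bullet> p / (\<bar>C\<bar> + 1)"] pos by linarith
  qed
  then have "p = 0" by (metis inner_gt_zero_iff not_less)
  then show ?thesis
    using that [of x \<mu>] x by (simp add: p_def W_def)
qed

text \<open>An orthonormal family of eigenvectors of largest cardinality must span: otherwise the
  preceding lemma adds one more. Such families are independent, so their cardinalities are bounded
  and a largest one exists.\<close>

theorem symmetric_spectral:
  fixes A :: "real^'n^'n"
  assumes sym: "transpose A = A"
  obtains U \<sigma> where "orthogonal_matrix U" "A = U ** diag_mat \<sigma> ** transpose U"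
proof -
  define \<E> where "\<E> = (\<lambda>B. (\<forall>b\<in>B. norm b = 1 \<and> (\<exists>\<mu>. A *v b = \<mu> *\<^sub>R b)) \<and> pairwise orthogonal B)"
  have ind: "independent B \<and> finite B \<and> card B \<le> CARD('n)" if "\<E> B" for B
  proof -
    have "0 \<notin> B" using that by (force simp: \<E>_def)
    then have "independent B"
      using that pairwise_orthogonal_independent by (auto simp: \<E>_def)
    then show ?thesis using independent_bound [of B] by auto
  qed
  have "\<exists>B. \<E> B \<and> (\<forall>C. \<E> C \<longrightarrow> card C \<le> card B)"
    by (rule ex_has_greatest_nat [of \<E> "{}" card "CARD('n) + 1"])
      (use ind in \<open>simp_all add: \<E>_def less_Suc_eq_le\<close>)
  then obtain B where B: "\<E> B" and Bmax: "\<And>C. \<E> C \<Longrightarrow> card C \<le> card B"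
    by blast
  have "span B = UNIV"
  proof (rule ccontr)
    assume "span B \<noteq> UNIV"
    then have "dim B < DIM(real^'n)"
      by (metis dim_eq_full dim_subset_UNIV le_neq_implies_less)
    then obtain z where "z \<noteq> 0" "\<And>y. y \<in> span B \<Longrightarrow> orthogonal z y"
      using orthogonal_to_subspace_exists by blast
    then obtain x \<mu> where x: "norm x = 1" "A *v x = \<mu> *\<^sub>R x" "\<And>b. b \<in> B \<Longrightarrow> b \<bullet> x = 0"
      using symmetric_eigenvector_complement [OF sym, of B z] B
      by (auto simp: \<E>_def orthogonal_def inner_commute span_base)
    have "x \<notin> B" using x by force
    moreover have "\<E> (insert x B)"
      using B x by (auto simp: \<E>_def pairwise_insert orthogonal_def inner_commute)
    ultimately show False
      using Bmax [of "insert x B"] ind [OF B] by simp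
  qed
  then have "card B = CARD('n)"
    using ind [OF B] by (metis DIM_cart DIM_real basis_card_eq_dim dim_UNIV dim_span mult.right_neutral top_greatest)
  then obtain e :: "'n \<Rightarrow> real^'n" where e: "bij_betw e UNIV B"
    using finite_same_card_bij [of "UNIV :: 'n set" B] ind [OF B] by auto
  have eB: "e i \<in> B" for i using e by (auto simp: bij_betw_def)
  have orth: "e i \<bullet> e j = (if i = j then 1 else 0)" for i j
  proof (cases "i = j")
    case True
    then show ?thesis using B eB [of i] by (auto simp: \<E>_def norm_eq_1)
  next
    case False
    then have "e i \<noteq> e j" using e by (auto simp: bij_betw_def inj_def)
    then show ?thesis using B eB [of i] eB [of j] False
      by (auto simp: \<E>_def pairwise_def orthogonal_def)
  qed
  have "\<forall>i. \<exists>\<mu>. A *v e i = \<mu> *\<^sub>R e i"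
    using B eB by (simp add: \<E>_def)
  then obtain \<sigma> where \<sigma>: "\<And>i. A *v e i = \<sigma> i *\<^sub>R e i"
    by metis
  define U :: "real^'n^'n" where "U = (\<chi> i j. e j $ i)"
  have UU: "transpose U ** U = mat 1"
    using orth by (simp add: U_def transpose_def matrix_matrix_mult_def vec_eq_iff mat_def inner_vec_def)
  then have U: "orthogonal_matrix U"
    by (simp add: orthogonal_matrix)
  have "A ** U = U ** diag_mat \<sigma>"
  proof -
    have "(A ** U) $ i $ j = (U ** diag_mat \<sigma>) $ i $ j" for i j
    proof -
      have "(A ** U) $ i $ j = (A *v e j) $ i"
        by (simp add: U_def matrix_matrix_mult_def matrix_vector_mult_def)
      also have "\<dots> = \<sigma> j * e j $ i" by (simp add: \<sigma>)
      also have "\<dots> = (U ** diag_mat \<sigma>) $ i $ j"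
        by (simp add: U_def matrix_matrix_mult_def diag_mat_def if_distrib [where f="\<lambda>x. _ * x"] cong: if_cong)
      finally show ?thesis .
    qed
    then show ?thesis by (simp add: vec_eq_iff)
  qed
  then have "A ** (U ** transpose U) = U ** diag_mat \<sigma> ** transpose U"
    by (simp add: matrix_mul_assoc)
  then have "A = U ** diag_mat \<sigma> ** transpose U"
    using U by (simp add: orthogonal_matrix_def)
  then show ?thesis by (rule that [OF U])
qed

lemma quadratic_form_diag:
  assumes "A = U ** diag_mat \<sigma> ** transpose U"
  shows "x \<bullet> (A *v x) = (\<Sum>k\<in>UNIV. \<sigma> k * ((transpose U *v x) $ k)\<^sup>2)"
proof -
  have "x \<bullet> (A *v x) = (transpose U *v x) \<bullet> (diag_mat \<sigma> *v (transpose U *v x))"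
    by (simp add: assms matrix_vector_mul_assoc [symmetric] dot_lmul_matrix [symmetric])
  then show ?thesis
    by (simp add: diag_mat_vector inner_vec_def power2_eq_square algebra_simps)
qed

lemma det_orthogonal_similar:
  fixes U :: "real^'n^'n"
  assumes "orthogonal_matrix U"
  shows "det (U ** D ** transpose U) = det D"
  using det_orthogonal_matrix [OF assms] by (auto simp: det_mul)

lemma trace_orthogonal_similar:
  fixes U :: "real^'n^'n"
  assumes "orthogonal_matrix U"
  shows "trace (U ** D ** transpose U) = trace D"
  by (metis assms matrix_mul_assoc matrix_mul_lid orthogonal_matrix trace_mul_sym)

section \<open>Positive definite matrices: spectrum, square root, log-determinant\<close>

lemma pos_def_symmetric: "pos_def A \<Longrightarrow> transpose A = A"
  by (simp add: pos_def_def)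

lemma pos_def_nonneg: "pos_def A \<Longrightarrow> 0 \<le> x \<bullet> (A *v x)"
  by (cases "x = 0") (auto simp: pos_def_def less_imp_le)

lemma pos_def_spectral:
  fixes A :: "real^'n^'n"
  assumes "pos_def A"
  obtains U \<sigma> where "orthogonal_matrix U" "A = U ** diag_mat \<sigma> ** transpose U" "\<And>k. 0 < \<sigma> k"
proof -
  obtain U \<sigma> where U: "orthogonal_matrix U" and A: "A = U ** diag_mat \<sigma> ** transpose U"
    using symmetric_spectral [OF pos_def_symmetric [OF assms]] .
  have "0 < \<sigma> k" for k
  proof -
    have Ux: "transpose U *v (U *v axis k 1) = axis k 1"
      using U by (metis matrix_vector_mul_assoc matrix_vector_mul_lid orthogonal_matrix)
    then have "U *v axis k 1 \<noteq> 0"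
      by (metis axis_eq_0_iff matrix_vector_mult_0_right zero_neq_one)
    then have "0 < (U *v axis k 1) \<bullet> (A *v (U *v axis k 1))"
      using assms by (simp add: pos_def_def)
    also have "\<dots> = (\<Sum>j\<in>UNIV. \<sigma> j * (axis k 1 $ j)\<^sup>2)"
      by (simp only: quadratic_form_diag [OF A] Ux)
    also have "\<dots> = (\<Sum>j\<in>UNIV. if j = k then \<sigma> k else 0)"
      by (intro sum.cong) (auto simp: axis_def)
    also have "\<dots> = \<sigma> k" by simp
    finally show ?thesis .
  qed
  with U A that show ?thesis by blast
qed

lemma pos_def_det:
  fixes A :: "real^'n^'n"
  assumes "pos_def A" shows "0 < det A"
proof -
  obtain U \<sigma> where "orthogonal_matrix U" "A = U ** diag_mat \<sigma> ** transpose U" "\<And>k. 0 < \<sigma> k"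
    using pos_def_spectral [OF assms] by blast
  then show ?thesis by (simp add: det_orthogonal_similar det_diag_mat prod_pos)
qed

lemma pos_def_sqrt:
  fixes A :: "real^'n^'n"
  assumes "pos_def A"
  obtains B where "pos_def B" "B ** B = A"
proof -
  obtain U \<sigma> where U: "orthogonal_matrix U" and A: "A = U ** diag_mat \<sigma> ** transpose U"
    and pos: "\<And>k. 0 < \<sigma> k"
    using pos_def_spectral [OF assms] by blast
  define B where "B = U ** diag_mat (\<lambda>k. sqrt (\<sigma> k)) ** transpose U"
  have "B ** B = U ** (diag_mat (\<lambda>k. sqrt (\<sigma> k)) ** (transpose U ** U) ** diag_mat (\<lambda>k. sqrt (\<sigma> k))) ** transpose U"
    by (simp add: B_def matrix_mul_assoc)
  also have "\<dots> = A"
    using U pos by (simp add: orthogonal_matrix diag_mat_matrix_mult A less_imp_le)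
  finally have BB: "B ** B = A" .
  have sym: "transpose B = B"
    by (simp add: B_def matrix_transpose_mul matrix_mul_assoc transpose_diag_mat)
  have "0 < y \<bullet> (B *v y)" if "y \<noteq> 0" for y
  proof -
    have "y = U *v (transpose U *v y)"
      using U by (metis matrix_vector_mul_assoc matrix_vector_mul_lid orthogonal_matrix_def)
    then have "transpose U *v y \<noteq> 0"
      using that by (metis matrix_vector_mult_0_right)
    then obtain k where "(transpose U *v y) $ k \<noteq> 0"
      by (auto simp: vec_eq_iff)
    then show ?thesis
      unfolding quadratic_form_diag [OF B_def]
      by (intro sum_pos2 [of _ k]) (auto simp: pos less_imp_le)
  qed
  with sym have "pos_def B" by (simp add: pos_def_def)
  with BB that show ?thesis by blast
qed

text \<open>Sum \<open>ln s \<le> s - 1\<close> over the eigenvalues. Equality in the sum forces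
  equality for each eigenvalue, hence all of them are 1.\<close>

lemma ln_det_le_trace:
  fixes X :: "real^'n^'n"
  assumes "pos_def X"
  shows "ln (det X) \<le> trace X - real CARD('n)"
    and "ln (det X) = trace X - real CARD('n) \<Longrightarrow> X = mat 1"
proof -
  obtain U \<sigma> where U: "orthogonal_matrix U" and X: "X = U ** diag_mat \<sigma> ** transpose U"
    and pos: "\<And>k. 0 < \<sigma> k"
    using pos_def_spectral [OF assms] by blast
  have ld: "ln (det X) = (\<Sum>k\<in>UNIV. ln (\<sigma> k))"
    using U X pos by (simp add: det_orthogonal_similar det_diag_mat ln_prod less_imp_neq [symmetric])
  have tr: "trace X - real CARD('n) = (\<Sum>k\<in>UNIV. \<sigma> k - 1)"
    using U X by (simp add: trace_orthogonal_similar trace_diag_mat sum_subtractf)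
  show "ln (det X) \<le> trace X - real CARD('n)"
    unfolding ld tr by (intro sum_mono ln_le_minus_one pos)
  assume "ln (det X) = trace X - real CARD('n)"
  then have "(\<Sum>k\<in>UNIV. (\<sigma> k - 1) - ln (\<sigma> k)) = 0"
    by (simp add: ld tr sum_subtractf)
  then have "(\<sigma> k - 1) - ln (\<sigma> k) = 0" for k
    using ln_le_minus_one [OF pos] by (subst (asm) sum_nonneg_eq_0_iff) auto
  then have "\<sigma> k = 1" for k
    using ln_eq_minus_one [OF pos] by (metis eq_iff_diff_eq_0)
  then have "diag_mat \<sigma> = mat 1"
    by (simp add: diag_mat_def mat_def vec_eq_iff)
  then show "X = mat 1"
    using U X by (simp add: orthogonal_matrix_def)
qed

text \<open>
  For each \<open>i\<close> this is concavity of \<open>ln\<close> against the spectral measure of \<open>S\<close> in direction \<open>w i\<close>;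
  isotropy makes the spectral measures add up to the trace of \<open>log S\<close>.
\<close>

lemma isotropic_jensen:
  fixes S :: "real^'n^'n" and w :: "'i \<Rightarrow> real^'n"
  assumes I: "finite I" "\<And>i. i \<in> I \<Longrightarrow> 0 \<le> l i"
    and iso: "\<And>y. (\<Sum>i\<in>I. l i * (w i \<bullet> y)\<^sup>2) = y \<bullet> y"
    and S: "pos_def S"
  shows "ln (det S) \<le> (\<Sum>i\<in>I. l i * ((w i \<bullet> w i) * ln ((w i \<bullet> (S *v w i)) / (w i \<bullet> w i))))"
proof -
  obtain U \<sigma> where U: "orthogonal_matrix U" and X: "S = U ** diag_mat \<sigma> ** transpose U"
    and pos: "\<And>k. 0 < \<sigma> k"
    using pos_def_spectral [OF S] by blast
  \<comment> \<open>The mass that the spectral measure of \<open>S\<close> in direction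
    \<open>w i\<close> puts on the \<open>k\<close>-th eigenvalue. Summing over \<open>k\<close>
    gives the squared norm of \<open>w i\<close>; the weighted sum over \<open>i\<close> gives
    1.\<close>
  define p where "p = (\<lambda>i k. ((transpose U *v w i) $ k)\<^sup>2)"
  have p_inner: "p i k = (w i \<bullet> (U *v axis k 1))\<^sup>2" for i k
    by (simp add: p_def dot_lmul_matrix [symmetric] inner_axis)
  have norm_p: "(\<Sum>k\<in>UNIV. p i k) = w i \<bullet> w i" for i
  proof -
    have "(\<Sum>k\<in>UNIV. p i k) = (transpose U *v w i) \<bullet> (transpose U *v w i)"
      by (simp add: p_def inner_vec_def power2_eq_square)
    also have "\<dots> = (U *v (transpose U *v w i)) \<bullet> w i"
      by (metis dot_lmul_matrix inner_commute transpose_matrix_vector)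
    also have "\<dots> = w i \<bullet> w i"
      using U by (metis matrix_vector_mul_assoc matrix_vector_mul_lid orthogonal_matrix_def)
    finally show ?thesis .
  qed
  have col: "(\<Sum>i\<in>I. l i * p i k) = 1" for k
  proof -
    have "(\<Sum>i\<in>I. l i * p i k) = (U *v axis k 1) \<bullet> (U *v axis k 1)"
      by (simp add: p_inner iso)
    also have "\<dots> = axis k 1 \<bullet> (transpose U *v (U *v axis k (1::real)))"
      by (simp add: dot_lmul_matrix [symmetric] inner_commute)
    also have "\<dots> = axis k 1 \<bullet> (axis k (1::real))"
      using U by (simp add: matrix_vector_mul_assoc orthogonal_matrix
         del: transpose_matrix_vector)
    also have "\<dots> = 1" by (simp add: inner_axis)
    finally show ?thesis .
  qed
  have wS: "w i \<bullet> (S *v w i) = (\<Sum>k\<in>UNIV. \<sigma> k * p i k)" for i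
    by (simp only: quadratic_form_diag [OF X] p_def)
  have concave: "(\<Sum>k\<in>UNIV. p i k * ln (\<sigma> k)) \<le> (w i \<bullet> w i) * ln ((w i \<bullet> (S *v w i)) / (w i \<bullet> w i))" for i
  proof (cases "w i = 0")
    case True
    then show ?thesis by (simp add: p_def)
  next
    case False
    define s where "s = (w i \<bullet> (S *v w i)) / (w i \<bullet> w i)"
    have s: "s > 0" using False S by (simp add: s_def pos_def_def)
    \<comment> \<open>Jensen in tangent form: \<open>ln\<close> lies below its tangent at the mean
      \<open>s\<close>, and the linear correction cancels because \<open>s\<close> is the mean of
      the eigenvalues under the normalised masses.\<close>
    have "(\<Sum>k\<in>UNIV. p i k * ln (\<sigma> k)) \<le> (\<Sum>k\<in>UNIV. p i k * (ln s + (\<sigma> k / s - 1)))"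
    proof (intro sum_mono mult_left_mono)
      fix k
      have "ln (\<sigma> k / s) \<le> \<sigma> k / s - 1"
        using pos s by (intro ln_le_minus_one) auto
      then show "ln (\<sigma> k) \<le> ln s + (\<sigma> k / s - 1)"
        using pos [of k] s by (simp add: ln_div)
    qed (simp add: p_def)
    also have "\<dots> = (w i \<bullet> w i) * (ln s - 1) + (w i \<bullet> (S *v w i)) / s"
      by (simp add: wS norm_p [symmetric] algebra_simps
          sum.distrib sum_subtractf sum_distrib_left sum_distrib_right sum_divide_distrib)
    also have "\<dots> = (w i \<bullet> w i) * ln s"
    proof -
      have "w i \<bullet> (S *v w i) \<noteq> 0" using False S by (auto simp: pos_def_def)
      then show ?thesis by (simp add: s_def algebra_simps)
    qed
    finally show ?thesis by (simp add: s_def)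
  qed
  have "ln (det S) = (\<Sum>k\<in>UNIV. ln (\<sigma> k))"
    using U X pos by (simp add: det_orthogonal_similar det_diag_mat ln_prod less_imp_neq [symmetric])
  also have "\<dots> = (\<Sum>k\<in>UNIV. (\<Sum>i\<in>I. l i * p i k) * ln (\<sigma> k))"
    by (simp add: col)
  also have "\<dots> = (\<Sum>i\<in>I. l i * (\<Sum>k\<in>UNIV. p i k * ln (\<sigma> k)))"
    by (simp add: sum_distrib_left sum_distrib_right mult.assoc) (rule sum.swap)
  also have "\<dots> \<le> (\<Sum>i\<in>I. l i * ((w i \<bullet> w i) * ln ((w i \<bullet> (S *v w i)) / (w i \<bullet> w i))))"
    by (intro sum_mono mult_left_mono concave I)
  finally show ?thesis .
qed

section \<open>Inverses and scaling\<close>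

lemma matrix_inv_unique:
  fixes A B :: "real^'n^'n"
  assumes "A ** B = mat 1"
  shows "matrix_inv A = B"
proof -
  have BA: "B ** A = mat 1" using assms matrix_left_right_inverse by blast
  have "A ** matrix_inv A = mat 1"
    using someI [of "\<lambda>A'. A ** A' = mat 1 \<and> A' ** A = mat 1" B] assms BA
    by (simp add: matrix_inv_def)
  then show ?thesis
    by (metis BA matrix_mul_assoc matrix_mul_lid matrix_mul_rid)
qed

lemma matrix_inv_cancel:
  fixes A :: "real^'n^'n"
  assumes "det A \<noteq> 0"
  shows "A ** matrix_inv A = mat 1" "matrix_inv A ** A = mat 1"
    "A *v (matrix_inv A *v x) = x" "matrix_inv A *v (A *v x) = x"
proof -
  obtain B where "A ** B = mat 1" "B ** A = mat 1"
    using assms unfolding invertible_det_nz [symmetric] invertible_def by blast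
  then show "A ** matrix_inv A = mat 1" "matrix_inv A ** A = mat 1"
    using matrix_inv_unique [of A B] by auto
  then show "A *v (matrix_inv A *v x) = x" "matrix_inv A *v (A *v x) = x"
    by (simp_all add: matrix_vector_mul_assoc)
qed

lemma det_matrix_inv:
  fixes A :: "real^'n^'n"
  assumes "det A \<noteq> 0"
  shows "det (matrix_inv A) = 1 / det A"
proof -
  have "det A * det (matrix_inv A) = 1"
    using matrix_inv_cancel(1) [OF assms] by (metis det_I det_mul)
  then show ?thesis using assms by (simp add: field_simps)
qed

lemma pos_def_det_nz: "pos_def A \<Longrightarrow> det A \<noteq> 0"
  using pos_def_det by (metis less_irrefl)

lemma matrix_inv_matrix_inv:
  fixes A :: "real^'n^'n"
  assumes "det A \<noteq> 0"
  shows "matrix_inv (matrix_inv A) = A"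
  by (rule matrix_inv_unique) (rule matrix_inv_cancel [OF assms])

lemma pos_def_matrix_inv:
  fixes A :: "real^'n^'n"
  assumes A: "pos_def A" shows "pos_def (matrix_inv A)"
proof -
  note nz = pos_def_det_nz [OF A]
  have "A ** transpose (matrix_inv A) = transpose (matrix_inv A ** A)"
    by (simp add: matrix_transpose_mul pos_def_symmetric [OF A])
  then have "transpose (matrix_inv A) = matrix_inv A"
    using matrix_inv_unique [of A "transpose (matrix_inv A)"] matrix_inv_cancel [OF nz] by simp
  moreover have "0 < y \<bullet> (matrix_inv A *v y)" if "y \<noteq> 0" for y
  proof -
    define z where "z = matrix_inv A *v y"
    have y: "y = A *v z" by (simp add: z_def matrix_inv_cancel [OF nz])
    then have "z \<noteq> 0" using that by auto
    then have "0 < z \<bullet> (A *v z)" using A by (simp add: pos_def_def)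
    then show ?thesis using y inner_commute [of z y] by (simp add: matrix_inv_cancel [OF nz])
  qed
  ultimately show ?thesis by (simp add: pos_def_def)
qed

lemma transpose_scaleR: "transpose (c *\<^sub>R A) = c *\<^sub>R transpose (A :: real^'n^'m)"
  by (simp add: transpose_def vec_eq_iff)

lemma pos_def_scaleR:
  assumes "pos_def A" "0 < c" shows "pos_def (c *\<^sub>R A)"
  using assms by (simp add: pos_def_def transpose_scaleR scaleR_matrix_vector_assoc [symmetric])

lemma det_scaleR:
  fixes A :: "real^'n^'n"
  shows "det (c *\<^sub>R A) = c ^ CARD('n) * det A"
proof -
  have "c *\<^sub>R A = diag_mat (\<lambda>_. c) ** A"
    by (simp add: diag_mat_def matrix_matrix_mult_def vec_eq_iff if_distrib [where f="\<lambda>x. x * _"] cong: if_cong)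
  then show ?thesis by (simp add: det_mul det_diag_mat)
qed

lemma matrix_inv_scaleR:
  fixes A :: "real^'n^'n"
  assumes "det A \<noteq> 0" "c \<noteq> 0"
  shows "matrix_inv (c *\<^sub>R A) = (1 / c) *\<^sub>R matrix_inv A"
proof (rule matrix_inv_unique)
  have "c *\<^sub>R A ** (1 / c) *\<^sub>R matrix_inv A = (c * (1 / c)) *\<^sub>R (A ** matrix_inv A)"
    by (simp add: matrix_matrix_mult_def vec_eq_iff sum_distrib_left algebra_simps)
  then show "c *\<^sub>R A ** (1 / c) *\<^sub>R matrix_inv A = mat 1"
    using assms by (simp add: matrix_inv_cancel)
qed

section \<open>Rank-one updates and determinant inequalities\<close>

lemma outer_vector: "outer c *v y = (c \<bullet> y) *\<^sub>R c"
  by (simp add: outer_def matrix_vector_mult_def vec_eq_iff inner_vec_def sum_distrib_left algebra_simps)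

lemma transpose_outer: "transpose (outer c) = outer c"
  by (simp add: outer_def transpose_def vec_eq_iff mult.commute)

lemma trace_mult_outer: "trace (A ** outer c) = c \<bullet> (A *v c)"
  by (simp add: trace_def outer_def matrix_matrix_mult_def matrix_vector_mult_def inner_vec_def
      sum_distrib_left algebra_simps)

lemma matrix_outer_matrix: "B ** outer u ** transpose B = outer (B *v u)"
  by (simp add: outer_def matrix_matrix_mult_def matrix_vector_mult_def transpose_def vec_eq_iff
      sum_product sum_distrib_left sum_distrib_right algebra_simps)

lemma transpose_diff: "transpose (A - B) = transpose A - transpose (B :: real^'n^'m)"
  by (simp add: transpose_def vec_eq_iff)

lemma matrix_scaleR_right: "A ** (t *\<^sub>R B) = t *\<^sub>R (A ** (B :: real^'n^'m))"
  by (simp add: matrix_matrix_mult_def vec_eq_iff sum_distrib_left algebra_simps)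

lemma matrix_scaleR_left: "(t *\<^sub>R A) ** B = t *\<^sub>R (A ** (B :: real^'n^'m))"
  by (simp add: matrix_matrix_mult_def vec_eq_iff sum_distrib_left algebra_simps)

lemma matrix_add_rdistrib: "(A + B) ** C = A ** C + B ** (C :: real^'n^'m)"
  by (simp add: matrix_matrix_mult_def vec_eq_iff sum.distrib algebra_simps)

text \<open>A rotation takes \<open>u\<close> to a multiple of a coordinate vector, and there the
  matrix is diagonal with a single entry different from 1. The index \<open>undefined\<close> stands
  for an arbitrary coordinate.\<close>

lemma det_id_add_outer:
  fixes u :: "real^'n"
  shows "det (mat 1 + t *\<^sub>R outer u) = 1 + t * (u \<bullet> u)"
proof (cases "u = 0")
  case True
  then have "outer u = 0" by (simp add: outer_def vec_eq_iff)
  then show ?thesis using True by simp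
next
  case False
  define e :: "real^'n" where "e = axis undefined 1"
  obtain U :: "real^'n^'n" where U: "orthogonal_matrix U" and Ue: "U *v e = (1 / norm u) *\<^sub>R u"
    using orthogonal_matrix_exists_basis [of "(1 / norm u) *\<^sub>R u" undefined] False
    by (auto simp: e_def)
  have u: "u = U *v (norm u *\<^sub>R e)"
    using False by (simp add: matrix_vector_mult_scaleR Ue)
  have "mat 1 + t *\<^sub>R outer u = U ** (mat 1 + t *\<^sub>R outer (norm u *\<^sub>R e)) ** transpose U"
    using U by (simp add: matrix_add_ldistrib matrix_add_rdistrib matrix_scaleR_left
        matrix_scaleR_right matrix_outer_matrix u [symmetric] orthogonal_matrix_def)
  moreover have "mat 1 + t *\<^sub>R outer (norm u *\<^sub>R e) = diag_mat (\<lambda>k. if k = undefined then 1 + t * (u \<bullet> u) else 1)"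
    by (auto simp: vec_eq_iff mat_def outer_def diag_mat_def e_def axis_def power2_norm_eq_inner [symmetric] power2_eq_square)
  ultimately show ?thesis
    by (simp add: det_orthogonal_similar [OF U] det_diag_mat)
qed

text \<open>The matrix determinant lemma. Factoring out the square root of \<open>A\<close> on both
  sides reduces it to a perturbation of the identity.\<close>

lemma det_add_outer:
  fixes A :: "real^'n^'n"
  assumes A: "pos_def A"
  shows "det (A + t *\<^sub>R outer u) = det A * (1 + t * (u \<bullet> (matrix_inv A *v u)))"
proof -
  obtain B where B: "pos_def B" and BB: "B ** B = A"
    using pos_def_sqrt [OF A] .
  note nz = pos_def_det_nz [OF B]
  define w where "w = matrix_inv B *v u"
  have u: "u = B *v w" by (simp add: w_def matrix_inv_cancel [OF nz])
  have "B ** outer w ** B = outer u"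
    using matrix_outer_matrix [of B w] by (simp add: pos_def_symmetric [OF B] u)
  then have "A + t *\<^sub>R outer u = B ** (mat 1 + t *\<^sub>R outer w) ** B"
    by (simp add: matrix_add_ldistrib matrix_add_rdistrib matrix_scaleR_left matrix_scaleR_right BB)
  then have "det (A + t *\<^sub>R outer u) = det (B ** B) * (1 + t * (w \<bullet> w))"
    by (simp add: det_mul det_id_add_outer)
  moreover have "w \<bullet> w = u \<bullet> (matrix_inv A *v u)"
  proof -
    have "A *v (matrix_inv B *v w) = u"
      by (simp add: BB [symmetric] matrix_vector_mul_assoc [symmetric] matrix_inv_cancel [OF nz] u)
    then have "matrix_inv A *v u = matrix_inv B *v w"
      using matrix_inv_cancel(4) [OF pos_def_det_nz [OF A]] by metis
    then have "u \<bullet> (matrix_inv A *v u) = (B *v w) \<bullet> (matrix_inv B *v w)"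
      by (simp add: u)
    also have "\<dots> = w \<bullet> w"
      by (simp only: symmetric_inner [OF pos_def_symmetric [OF B]] matrix_inv_cancel [OF nz])
    finally show ?thesis by simp
  qed
  ultimately show ?thesis by (simp add: BB)
qed

text \<open>With \<open>B\<close> the square root of \<open>T\<close>, the matrix
  \<open>B ** A ** B\<close> is symmetric and has the determinant and the trace of
  \<open>A ** T\<close>, so the inequality for a single matrix applies, including its equality
  case.\<close>

lemma ln_det_mult_le_trace:
  fixes A T :: "real^'n^'n"
  assumes A: "pos_def A" and T: "pos_def T"
  shows "ln (det A) + ln (det T) \<le> trace (A ** T) - real CARD('n)"
    and "ln (det A) + ln (det T) = trace (A ** T) - real CARD('n) \<Longrightarrow> A = matrix_inv T"
proof -
  obtain B where B: "pos_def B" and BB: "B ** B = T"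
    using pos_def_sqrt [OF T] .
  note nz = pos_def_det_nz [OF B] and symB = pos_def_symmetric [OF B]
  define X where "X = B ** A ** B"
  have "0 < y \<bullet> (X *v y)" if "y \<noteq> 0" for y
  proof -
    have "B *v y \<noteq> 0" using that matrix_inv_cancel(4) [OF nz]
      by (metis matrix_vector_mult_0_right)
    then have "0 < (B *v y) \<bullet> (A *v (B *v y))" using A by (simp add: pos_def_def)
    then show ?thesis
      by (simp add: X_def symmetric_inner [OF symB] matrix_vector_mul_assoc matrix_mul_assoc)
  qed
  moreover have "transpose X = X"
    by (simp add: X_def matrix_transpose_mul symB pos_def_symmetric [OF A] matrix_mul_assoc)
  ultimately have X: "pos_def X" by (simp add: pos_def_def)
  have tr: "trace X = trace (A ** T)"
    by (metis BB X_def matrix_mul_assoc trace_mul_sym)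
  have "det X = det A * det T"
    by (simp add: X_def BB [symmetric] det_mul)
  then have ld: "ln (det X) = ln (det A) + ln (det T)"
    using pos_def_det [OF A] pos_def_det [OF T] by (simp add: ln_mult)
  show "ln (det A) + ln (det T) \<le> trace (A ** T) - real CARD('n)"
    using ln_det_le_trace(1) [OF X] by (simp add: ld tr)
  assume "ln (det A) + ln (det T) = trace (A ** T) - real CARD('n)"
  then have "X = mat 1" using ln_det_le_trace(2) [OF X] by (simp add: ld tr)
  then have "B ** (A ** B) = mat 1" by (simp add: X_def matrix_mul_assoc)
  then have "(A ** B) ** B = mat 1" using matrix_left_right_inverse by blast
  then have "A ** T = mat 1" by (simp add: BB [symmetric] matrix_mul_assoc)
  then have "T ** A = mat 1" using matrix_left_right_inverse by blast
  then show "A = matrix_inv T" by (simp add: matrix_inv_unique)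
qed

text \<open>Cauchy-Schwarz for the inner product of \<open>Q\<close>, applied to
  \<open>matrix_inv Q *v y\<close> and \<open>z\<close>. It comes from evaluating the form at the
  combination that removes the component along \<open>z\<close>.\<close>

lemma pos_def_cauchy_schwarz:
  fixes Q :: "real^'n^'n"
  assumes Q: "pos_def Q"
  shows "(y \<bullet> z)\<^sup>2 \<le> (y \<bullet> (matrix_inv Q *v y)) * (z \<bullet> (Q *v z))"
proof -
  define w where "w = matrix_inv Q *v y"
  have y: "y = Q *v w" by (simp add: w_def matrix_inv_cancel [OF pos_def_det_nz [OF Q]])
  define a where "a = z \<bullet> (Q *v z)"
  have "w \<bullet> (Q *v z) = y \<bullet> z"
    by (simp add: y symmetric_inner [OF pos_def_symmetric [OF Q]])
  moreover have "0 \<le> (a *\<^sub>R w - (y \<bullet> z) *\<^sub>R z) \<bullet> (Q *v (a *\<^sub>R w - (y \<bullet> z) *\<^sub>R z))"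
    by (rule pos_def_nonneg [OF Q])
  moreover have "z \<bullet> (Q *v w) = y \<bullet> z"
    by (simp add: y inner_commute)
  ultimately have "0 \<le> a * (a * (w \<bullet> y) - (y \<bullet> z)\<^sup>2)"
    by (simp add: matrix_vector_mult_diff_distrib matrix_vector_mult_scaleR inner_diff_left
        inner_diff_right y [symmetric] a_def [symmetric] algebra_simps power2_eq_square)
  moreover have "0 < a" if "z \<noteq> 0"
    using that Q by (simp add: a_def pos_def_def)
  ultimately show ?thesis
    by (cases "z = 0") (auto simp: a_def [symmetric] w_def [symmetric] inner_commute zero_le_mult_iff algebra_simps)
qed

section \<open>Ellipsoids and their polars\<close>

text \<open>Polarisation recovers the bilinear form from the quadratic one.\<close>

lemma symmetric_eqI:
  fixes A B :: "real^'n^'n"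
  assumes A: "transpose A = A" and B: "transpose B = B"
    and eq: "\<And>y. y \<bullet> (A *v y) = y \<bullet> (B *v y)"
  shows "A = B"
proof -
  have bil: "x \<bullet> (A *v y) = x \<bullet> (B *v y)" for x y
  proof -
    have "y \<bullet> (A *v x) = x \<bullet> (A *v y)" "y \<bullet> (B *v x) = x \<bullet> (B *v y)"
      by (metis A B symmetric_inner inner_commute)+
    then show ?thesis
      using eq [of "x + y"] eq [of x] eq [of y]
      by (simp add: matrix_vector_right_distrib inner_add_left inner_add_right)
  qed
  then have "A *v y = B *v y" for y
    by (metis vector_eq_rdot inner_commute)
  then show ?thesis by (simp add: matrix_eq)
qed

text \<open>This makes the definite description in \<open>ellipsoid_params\<close> meaningful. If
  the centres differed, the line through them would meet the common set in a segment with two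
  different midpoints. With equal centres, scaling a vector to the boundary compares the two
  forms.\<close>

lemma ellipsoid_inj:
  fixes Q Q' :: "real^'n^'n"
  assumes Q: "pos_def Q" and Q': "pos_def Q'" and eq: "ellipsoid c Q = ellipsoid c' Q'"
  shows "c = c'" "Q = Q'"
proof -
  show cc: "c = c'"
  proof (rule ccontr)
    assume "c \<noteq> c'"
    define d where "d = c' - c"
    have d: "d \<noteq> 0" using \<open>c \<noteq> c'\<close> by (simp add: d_def)
    define \<alpha> where "\<alpha> = sqrt (d \<bullet> (Q *v d))"
    define \<beta> where "\<beta> = sqrt (d \<bullet> (Q' *v d))"
    have pos: "\<alpha> > 0" "\<beta> > 0" using d Q Q' by (auto simp: \<alpha>_def \<beta>_def pos_def_def)
    have 1: "c + t *\<^sub>R d \<in> ellipsoid c Q \<longleftrightarrow> \<bar>t * \<alpha>\<bar> \<le> 1" for t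
      using pos_def_nonneg [OF Q, of d]
      by (simp add: ellipsoid_def matrix_vector_mult_scaleR abs_square_le_1 [symmetric]
          power_mult_distrib \<alpha>_def) (simp add: power2_eq_square mult.assoc)
    have 2: "c + t *\<^sub>R d \<in> ellipsoid c' Q' \<longleftrightarrow> \<bar>(t - 1) * \<beta>\<bar> \<le> 1" for t
    proof -
      have "c + t *\<^sub>R d - c' = (t - 1) *\<^sub>R d" by (simp add: d_def algebra_simps)
      then show ?thesis
        using pos_def_nonneg [OF Q', of d]
        by (simp add: ellipsoid_def matrix_vector_mult_scaleR abs_square_le_1 [symmetric]
          power_mult_distrib \<beta>_def) (simp add: power2_eq_square mult.assoc)
    qed
    \<comment> \<open>The end of the first segment lying away from \<open>c'\<close> and the end of
      the second lying away from \<open>c\<close> must belong to both sets; this yields both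
      \<open>\<beta> < \<alpha>\<close> and \<open>\<alpha> < \<beta>\<close>.\<close>
    have "\<bar>(- (1 / \<alpha>) - 1) * \<beta>\<bar> \<le> 1" "\<bar>(1 + 1 / \<beta>) * \<alpha>\<bar> \<le> 1"
      using 1 [of "- (1 / \<alpha>)"] 2 [of "- (1 / \<alpha>)"] 1 [of "1 + 1 / \<beta>"] 2 [of "1 + 1 / \<beta>"] pos eq
      by auto
    then have "(1 / \<alpha> + 1) * \<beta> \<le> 1" "(1 + 1 / \<beta>) * \<alpha> \<le> 1"
      using pos by (auto simp: abs_le_iff algebra_simps)
    then have "\<beta> / \<alpha> + \<beta> \<le> 1" "\<alpha> + \<alpha> / \<beta> \<le> 1"
      by (auto simp: algebra_simps)
    then have "\<beta> / \<alpha> < 1" "\<alpha> / \<beta> < 1"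
      using pos by linarith+
    then show False using pos by (simp add: divide_less_eq)
  qed
  show "Q = Q'"
  proof (rule symmetric_eqI)
    fix y
    have le: "y \<bullet> (B *v y) \<le> y \<bullet> (A *v y)"
      if A: "pos_def A" and sub: "ellipsoid c A \<subseteq> ellipsoid c B" for A B
    proof (cases "y = 0")
      case False
      define a where "a = y \<bullet> (A *v y)"
      have a: "a > 0" using A False by (simp add: a_def pos_def_def)
      have "c + (1 / sqrt a) *\<^sub>R y \<in> ellipsoid c A"
        using a by (simp add: ellipsoid_def matrix_vector_mult_scaleR a_def [symmetric])
      then have "c + (1 / sqrt a) *\<^sub>R y \<in> ellipsoid c B" using sub by blast
      then have "(y \<bullet> (B *v y)) / a \<le> 1"
        using a by (simp add: ellipsoid_def matrix_vector_mult_scaleR)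
      then show ?thesis using a by (simp add: divide_le_eq a_def)
    qed simp
    show "y \<bullet> (Q *v y) = y \<bullet> (Q' *v y)"
      using le [of Q Q'] le [of Q' Q] Q Q' eq cc by (simp add: order_antisym)
  qed (use Q Q' in \<open>auto simp: pos_def_symmetric\<close>)
qed

lemma ellipsoid_params_ellipsoid:
  assumes "pos_def Q" shows "ellipsoid_params (ellipsoid c Q) = (c, Q)"
  unfolding ellipsoid_params_def
proof (rule the_equality)
  fix p assume "pos_def (snd p) \<and> ellipsoid c Q = ellipsoid (fst p) (snd p)"
  then show "p = (c, Q)"
    using ellipsoid_inj [OF assms] by (metis prod.collapse)
qed (use assms in auto)

lemma center_ellipsoid: "pos_def Q \<Longrightarrow> center (ellipsoid c Q) = c"
  by (simp add: center_def ellipsoid_params_ellipsoid)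

lemma shape_ellipsoid: "pos_def Q \<Longrightarrow> shape (ellipsoid c Q) = Q"
  by (simp add: shape_def ellipsoid_params_ellipsoid)

lemma Vol_ellipsoid: "pos_def Q \<Longrightarrow> Vol (ellipsoid c Q) = det Q powr (- 1 / 2)"
  by (simp add: Vol_def shape_ellipsoid)

lemma ln_Vol_ellipsoid: "pos_def Q \<Longrightarrow> ln (Vol (ellipsoid c Q)) = - ln (det Q) / 2"
  using pos_def_det [of Q] by (simp add: Vol_ellipsoid ln_powr)

lemma Vol_ellipsoid_le_iff:
  assumes "pos_def Q" "pos_def Q'"
  shows "Vol (ellipsoid c Q) \<le> Vol (ellipsoid c' Q') \<longleftrightarrow> ln (det Q') \<le> ln (det Q)"
proof -
  have "Vol (ellipsoid c Q) > 0" "Vol (ellipsoid c' Q') > 0"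
    using assms pos_def_det_nz by (auto simp: Vol_ellipsoid)
  then have "Vol (ellipsoid c Q) \<le> Vol (ellipsoid c' Q') \<longleftrightarrow>
      ln (Vol (ellipsoid c Q)) \<le> ln (Vol (ellipsoid c' Q'))"
    by simp
  then show ?thesis by (simp add: ln_Vol_ellipsoid assms)
qed

text \<open>The left side of the last inequality is the support function of the ellipsoid.
  Cauchy-Schwarz bounds it, and the point in direction \<open>matrix_inv Q *v y\<close> on the
  boundary attains it.\<close>

lemma ellipsoid_support:
  fixes Q :: "real^'n^'n"
  assumes Q: "pos_def Q"
  shows "(\<forall>s\<in>ellipsoid c Q. y \<bullet> s \<le> \<beta>) \<longleftrightarrow> y \<bullet> c + sqrt (y \<bullet> (matrix_inv Q *v y)) \<le> \<beta>"
proof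
  assume sup: "\<forall>s\<in>ellipsoid c Q. y \<bullet> s \<le> \<beta>"
  show "y \<bullet> c + sqrt (y \<bullet> (matrix_inv Q *v y)) \<le> \<beta>"
  proof (cases "y = 0")
    case True
    moreover have "c \<in> ellipsoid c Q" by (simp add: ellipsoid_def)
    ultimately show ?thesis using sup by fastforce
  next
    case False
    define q where "q = y \<bullet> (matrix_inv Q *v y)"
    have q: "q > 0" using False pos_def_matrix_inv [OF Q] by (simp add: q_def pos_def_def)
    have "c + (1 / sqrt q) *\<^sub>R (matrix_inv Q *v y) \<in> ellipsoid c Q"
      using q by (simp add: ellipsoid_def matrix_vector_mult_scaleR inner_commute
          matrix_inv_cancel [OF pos_def_det_nz [OF Q]] q_def [symmetric])
    then have "y \<bullet> (c + (1 / sqrt q) *\<^sub>R (matrix_inv Q *v y)) \<le> \<beta>" using sup by blast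
    then show ?thesis using q by (simp add: inner_add_right q_def [symmetric] real_div_sqrt)
  qed
next
  assume le: "y \<bullet> c + sqrt (y \<bullet> (matrix_inv Q *v y)) \<le> \<beta>"
  show "\<forall>s\<in>ellipsoid c Q. y \<bullet> s \<le> \<beta>"
  proof
    fix s assume "s \<in> ellipsoid c Q"
    then have s: "(s - c) \<bullet> (Q *v (s - c)) \<le> 1" by (simp add: ellipsoid_def)
    have "(y \<bullet> (s - c))\<^sup>2 \<le> (y \<bullet> (matrix_inv Q *v y)) * ((s - c) \<bullet> (Q *v (s - c)))"
      by (rule pos_def_cauchy_schwarz [OF Q])
    also have "\<dots> \<le> y \<bullet> (matrix_inv Q *v y)"
      using mult_left_mono [OF s pos_def_nonneg [OF pos_def_matrix_inv [OF Q], of y]] by simp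
    finally have "y \<bullet> (s - c) \<le> sqrt (y \<bullet> (matrix_inv Q *v y))"
      by (rule real_le_rsqrt)
    then show "y \<bullet> s \<le> \<beta>" using le by (simp add: inner_diff_right)
  qed
qed

text \<open>The second hypothesis places the origin strictly inside \<open>ellipsoid c Q\<close>; by
  Cauchy-Schwarz the rank-one term is then strictly dominated by
  \<open>matrix_inv Q\<close>.\<close>

lemma pos_def_inv_diff_outer:
  fixes Q :: "real^'n^'n"
  assumes Q: "pos_def Q" and \<tau>: "c \<bullet> (Q *v c) < 1"
  shows "pos_def (matrix_inv Q - outer c)"
proof -
  have "0 < y \<bullet> ((matrix_inv Q - outer c) *v y)" if "y \<noteq> 0" for y
  proof -
    have p: "0 < y \<bullet> (matrix_inv Q *v y)"
      using that pos_def_matrix_inv [OF Q] by (simp add: pos_def_def)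
    have "(y \<bullet> c)\<^sup>2 \<le> (y \<bullet> (matrix_inv Q *v y)) * (c \<bullet> (Q *v c))"
      by (rule pos_def_cauchy_schwarz [OF Q])
    also have "\<dots> < y \<bullet> (matrix_inv Q *v y)"
      using mult_strict_left_mono [OF \<tau> p] by simp
    finally show ?thesis
      by (simp add: matrix_vector_mult_diff_rdistrib outer_vector inner_diff_right power2_eq_square inner_commute)
  qed
  then show ?thesis
    using pos_def_symmetric [OF pos_def_matrix_inv [OF Q]]
    by (simp add: pos_def_def transpose_diff transpose_outer)
qed

text \<open>Membership in the polar says that the support function at \<open>y\<close> is at most 1.
  Isolating the square root and squaring gives a quadratic inequality, and completing the square
  exhibits the centre and the shape.\<close>

lemma polar_ellipsoid:
  fixes Q :: "real^'n^'n"
  assumes Q: "pos_def Q" and \<tau>: "c \<bullet> (Q *v c) < 1"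
  shows "polar_set (ellipsoid c Q) =
    ellipsoid (- (1 / (1 - c \<bullet> (Q *v c))) *\<^sub>R (Q *v c))
      ((1 - c \<bullet> (Q *v c)) *\<^sub>R (matrix_inv Q - outer c))"
proof -
  define t where "t = c \<bullet> (Q *v c)"
  define M where "M = matrix_inv Q - outer c"
  define x where "x = - (1 / (1 - t)) *\<^sub>R (Q *v c)"
  have t: "t < 1" using \<tau> by (simp add: t_def)
  have M: "pos_def M" unfolding M_def by (rule pos_def_inv_diff_outer [OF Q \<tau>])
  have "M *v (Q *v c) = (1 - t) *\<^sub>R c"
    by (simp add: M_def matrix_vector_mult_diff_rdistrib outer_vector t_def algebra_simps
        matrix_inv_cancel [OF pos_def_det_nz [OF Q]])
  then have Mx: "M *v x = - c"
    using t matrix_vector_mult_scaleR [of M "- (1 / (1 - t))" "Q *v c"] by (simp add: x_def)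
  have xc: "x \<bullet> c = - t / (1 - t)"
    by (simp add: x_def t_def inner_commute)
  have "y \<in> polar_set (ellipsoid c Q) \<longleftrightarrow> y \<in> ellipsoid x ((1 - t) *\<^sub>R M)" for y
  proof -
    define p where "p = y \<bullet> (matrix_inv Q *v y)"
    define r where "r = y \<bullet> c"
    have p: "0 \<le> p" unfolding p_def by (rule pos_def_nonneg [OF pos_def_matrix_inv [OF Q]])
    have "r\<^sup>2 \<le> p * t" unfolding p_def r_def t_def by (rule pos_def_cauchy_schwarz [OF Q])
    also have "\<dots> \<le> p" using mult_left_mono [OF less_imp_le [OF t] p] by simp
    finally have rp: "r\<^sup>2 \<le> p" .
    have "y \<in> polar_set (ellipsoid c Q) \<longleftrightarrow> r + sqrt p \<le> 1"
      unfolding polar_set_def p_def r_def by (simp add: ellipsoid_support [OF Q])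
    also have "\<dots> \<longleftrightarrow> p - r\<^sup>2 + 2 * r \<le> 1"
    proof
      assume "r + sqrt p \<le> 1"
      then have "sqrt p \<le> 1 - r" by simp
      then have "(sqrt p)\<^sup>2 \<le> (1 - r)\<^sup>2" using p by (intro power_mono) auto
      then show "p - r\<^sup>2 + 2 * r \<le> 1" using p by (simp add: power2_eq_square algebra_simps)
    \<comment> \<open>Squaring can be undone because Cauchy-Schwarz gives
      \<open>r\<^sup>2 \<le> p\<close>, which turns the quadratic inequality into
      \<open>r \<le> 1 / 2\<close> and so makes \<open>1 - r\<close> nonnegative.\<close>
    next
      assume le: "p - r\<^sup>2 + 2 * r \<le> 1"
      then have "r \<le> 1 / 2" using rp by simp
      moreover have "p \<le> (1 - r)\<^sup>2" using le by (simp add: power2_eq_square algebra_simps)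
      ultimately have "sqrt p \<le> 1 - r" by (intro real_le_lsqrt) auto
      then show "r + sqrt p \<le> 1" by simp
    qed
    also have "\<dots> \<longleftrightarrow> y \<bullet> (M *v y) + 2 * r + t / (1 - t) \<le> 1 / (1 - t)"
    proof -
      have "y \<bullet> (M *v y) = p - r\<^sup>2"
        by (simp add: M_def p_def r_def matrix_vector_mult_diff_rdistrib outer_vector
            inner_diff_right power2_eq_square inner_commute)
      moreover have "1 / (1 - t) - t / (1 - t) = 1" using t by (simp add: diff_divide_distrib [symmetric])
      ultimately show ?thesis by (auto simp: algebra_simps)
    qed
    also have "y \<bullet> (M *v y) + 2 * r + t / (1 - t) = (y - x) \<bullet> (M *v (y - x))"
    proof -
      have "x \<bullet> (M *v y) = - r"
        using symmetric_inner [OF pos_def_symmetric [OF M], of x y] by (simp add: Mx r_def inner_commute)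
      then show ?thesis
        by (simp add: matrix_vector_mult_diff_distrib inner_diff_left inner_diff_right inner_add_right Mx xc r_def)
    qed
    also have "\<dots> \<le> 1 / (1 - t) \<longleftrightarrow> y \<in> ellipsoid x ((1 - t) *\<^sub>R M)"
      using t by (simp add: ellipsoid_def scaleR_matrix_vector_assoc [symmetric] pos_le_divide_eq mult.commute)
    finally show ?thesis .
  qed
  then show ?thesis unfolding x_def t_def M_def by blast
qed

text \<open>The scaling contributes one factor per dimension and the rank-one update one more. This
  exponent is the source of the factor \<open>CARD('n) + 1\<close> in the descent estimate.\<close>

lemma det_polar_shape:
  fixes Q :: "real^'n^'n"
  assumes Q: "pos_def Q" and \<tau>: "c \<bullet> (Q *v c) < 1"
  shows "det ((1 - c \<bullet> (Q *v c)) *\<^sub>R (matrix_inv Q - outer c))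
    = (1 - c \<bullet> (Q *v c)) ^ (CARD('n) + 1) / det Q"
proof -
  have "det (matrix_inv Q - outer c) = det (matrix_inv Q) * (1 - c \<bullet> (Q *v c))"
    using det_add_outer [OF pos_def_matrix_inv [OF Q], of "-1" c]
    by (simp add: matrix_inv_matrix_inv [OF pos_def_det_nz [OF Q]])
  then show ?thesis
    by (simp add: det_scaleR det_matrix_inv [OF pos_def_det_nz [OF Q]])
qed

section \<open>Lifting by one dimension\<close>

text \<open>The index \<open>None\<close> is the homogeneous coordinate added to the coordinates
  \<open>Some i\<close>.\<close>

definition lift_vec :: "real^'n \<Rightarrow> real \<Rightarrow> real^('n option)" where
  "lift_vec z s = (\<chi> j. case j of None \<Rightarrow> s | Some i \<Rightarrow> z $ i)"

definition lift_mat :: "real^'n^'n \<Rightarrow> real^('n option)^('n option)" where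
  "lift_mat A = (\<chi> j k. case j of None \<Rightarrow> (case k of None \<Rightarrow> 1 | Some _ \<Rightarrow> 0)
     | Some i \<Rightarrow> (case k of None \<Rightarrow> 0 | Some l \<Rightarrow> A $ i $ l))"

definition shear_mat :: "real^'n \<Rightarrow> real^('n option)^('n option)" where
  "shear_mat v = (\<chi> j. if j = None then lift_vec v 1 else axis j 1)"

lemma sum_option: "(\<Sum>j\<in>UNIV. f j) = f None + (\<Sum>i\<in>UNIV. f (Some (i :: 'n::finite)))"
  by (simp add: UNIV_option_conv sum.reindex)

lemma prod_option: "(\<Prod>j\<in>UNIV. f j) = f None * (\<Prod>i\<in>UNIV. f (Some (i :: 'n::finite)))"
  by (simp add: UNIV_option_conv prod.reindex)

lemma vec_option_eqI:
  fixes x y :: "'a^('n::finite option)"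
  shows "x $ None = y $ None \<Longrightarrow> (\<And>i. x $ Some i = y $ Some i) \<Longrightarrow> x = y"
  by (metis option.exhaust vec_eq_iff)

lemma lift_vec_nth [simp]: "lift_vec z s $ None = s" "lift_vec z s $ Some i = z $ i"
  by (simp_all add: lift_vec_def)

lemma lift_mat_nth [simp]:
  "lift_mat A $ None $ None = 1" "lift_mat A $ None $ Some k = 0"
  "lift_mat A $ Some i $ None = 0" "lift_mat A $ Some i $ Some k = A $ i $ k"
  by (simp_all add: lift_mat_def)

lemma lift_vec_cases: obtains z s where "x = lift_vec z s"
proof
  show "x = lift_vec (\<chi> i. x $ Some i) (x $ None)"
    by (rule vec_option_eqI) simp_all
qed

lemma inner_lift_vec: "lift_vec z s \<bullet> lift_vec z' s' = z \<bullet> z' + s * s'"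
  by (simp add: inner_vec_def sum_option)

lemma lift_vec_eq_0_iff: "lift_vec z s = 0 \<longleftrightarrow> z = 0 \<and> s = 0"
  by (metis (no_types, opaque_lifting) add_nonneg_eq_0_iff inner_eq_zero_iff inner_ge_zero inner_lift_vec
      mult_eq_0_iff zero_le_square)

lemma lift_mat_vector: "lift_mat A *v lift_vec z s = lift_vec (A *v z) s"
  by (rule vec_option_eqI) (simp_all add: matrix_vector_mult_def sum_option)

lemma lift_mat_mult: "lift_mat A ** lift_mat B = lift_mat (A ** B)"
  by (rule vec_option_eqI; rule vec_option_eqI) (simp_all add: matrix_matrix_mult_def sum_option)

lemma transpose_lift_mat: "transpose (lift_mat A) = lift_mat (transpose A)"
  by (rule vec_option_eqI; rule vec_option_eqI) (simp_all add: transpose_def)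

lemma lift_mat_id: "lift_mat (mat 1) = mat 1"
  by (rule vec_option_eqI; rule vec_option_eqI) (simp_all add: mat_def)

lemma lift_diag_mat: "lift_mat (diag_mat \<sigma>) = diag_mat (case_option 1 \<sigma>)"
  by (rule vec_option_eqI; rule vec_option_eqI) (simp_all add: diag_mat_def)

text \<open>Diagonalise \<open>A\<close>: the lifted orthogonal matrix is orthogonal and conjugates
  the lift to a diagonal matrix with one additional entry 1.\<close>

lemma det_lift_mat:
  assumes "transpose A = A" shows "det (lift_mat A) = det A"
proof -
  obtain U \<sigma> where U: "orthogonal_matrix U" and A: "A = U ** diag_mat \<sigma> ** transpose U"
    using symmetric_spectral [OF assms] .
  have "orthogonal_matrix (lift_mat U)"
    using U by (simp add: orthogonal_matrix transpose_lift_mat lift_mat_mult lift_mat_id)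
  moreover have "lift_mat A = lift_mat U ** lift_mat (diag_mat \<sigma>) ** transpose (lift_mat U)"
    by (simp add: A lift_mat_mult transpose_lift_mat)
  ultimately show ?thesis
    by (simp add: det_orthogonal_similar U A lift_diag_mat det_diag_mat prod_option)
qed

lemma pos_def_lift_mat:
  assumes "pos_def A" shows "pos_def (lift_mat A)"
proof -
  have "0 < y \<bullet> (lift_mat A *v y)" if "y \<noteq> 0" for y
  proof -
    obtain z s where y: "y = lift_vec z s" by (rule lift_vec_cases)
    have "0 < z \<bullet> (A *v z) + s * s"
    proof (cases "z = 0")
      case True
      then have "s \<noteq> 0" using that by (simp add: y lift_vec_eq_0_iff)
      then show ?thesis using True by (simp add: zero_less_mult_iff linorder_neq_iff disj_commute)
    next
      case False
      then show ?thesis using assms by (simp add: pos_def_def add_pos_nonneg)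
    qed
    then show ?thesis by (simp add: y lift_mat_vector inner_lift_vec)
  qed
  then show ?thesis using assms by (simp add: pos_def_def transpose_lift_mat)
qed

lemma shear_mat_vector: "shear_mat v *v lift_vec z s = lift_vec z (v \<bullet> z + s)"
  by (rule vec_option_eqI)
    (simp_all add: shear_mat_def matrix_vector_mult_def sum_option axis_def inner_vec_def
      if_distrib [where f="\<lambda>x. x * _"] cong: if_cong)

lemma transpose_shear_mat_vector: "transpose (shear_mat v) *v lift_vec z s = lift_vec (z + s *\<^sub>R v) s"
proof (rule vec_option_eqI)
  show "(transpose (shear_mat v) *v lift_vec z s) $ None = lift_vec (z + s *\<^sub>R v) s $ None"
    by (simp add: shear_mat_def matrix_vector_mult_def transpose_def sum_option axis_def
        del: transpose_matrix_vector)
  show "(transpose (shear_mat v) *v lift_vec z s) $ Some i = lift_vec (z + s *\<^sub>R v) s $ Some i" for i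
    by (simp add: shear_mat_def matrix_vector_mult_def transpose_def sum_option axis_def
        if_distrib [where f="\<lambda>x. x * _"] del: transpose_matrix_vector cong: if_cong)
qed

text \<open>Row \<open>None\<close> differs from that of the identity by a combination of the other
  rows, which leaves the determinant unchanged.\<close>

lemma det_shear_mat:
  fixes v :: "real^'n"
  shows "det (shear_mat v) = 1"
proof -
  have "lift_vec v 0 = (\<Sum>i\<in>UNIV. v $ i *s row (Some i) (mat 1))"
    by (rule vec_option_eqI) (simp_all add: row_def mat_def if_distrib [where f="\<lambda>x. _ * x"] cong: if_cong)
  then have "lift_vec v 0 \<in> vec.span {row j (mat 1 :: real^('n option)^('n option)) | j. j \<noteq> None}"
    by (simp only:, intro vec.span_sum, intro vec.span_scale, intro vec.span_base) auto
  from det_row_span [OF this]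
  have "det (\<chi> k. if k = None then row None (mat 1) + lift_vec v 0 else row k (mat 1)) = 1"
    by simp
  also have "(\<chi> k. if k = None then row None (mat 1) + lift_vec v 0 else row k (mat 1)) = shear_mat v"
    by (rule vec_option_eqI; rule vec_option_eqI)
      (auto simp: shear_mat_def row_def mat_def axis_def)
  finally show ?thesis .
qed

lemma pos_def_congruence:
  fixes A G :: "real^'n^'n"
  assumes A: "pos_def A" and G: "det G \<noteq> 0"
  shows "pos_def (transpose G ** A ** G)"
proof -
  have "0 < y \<bullet> ((transpose G ** A ** G) *v y)" if "y \<noteq> 0" for y
  proof -
    have "G *v y \<noteq> 0" using that matrix_inv_cancel(4) [OF G]
      by (metis matrix_vector_mult_0_right)
    then have "0 < (G *v y) \<bullet> (A *v (G *v y))" using A by (simp add: pos_def_def)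
    also have "\<dots> = y \<bullet> (transpose G *v (A *v (G *v y)))"
      by (metis dot_lmul_matrix inner_commute transpose_matrix_vector)
    finally show ?thesis
      by (simp add: matrix_vector_mul_assoc matrix_mul_assoc)
  qed
  then show ?thesis
    by (simp add: pos_def_def matrix_transpose_mul matrix_mul_assoc pos_def_symmetric [OF A])
qed

text \<open>
  In the lifted coordinates \<open>(b, 1)\<close> the projective map \<open>b \<mapsto> b / (1 - h \<bullet> b)\<close> becomes a shear, so
  that Jensen's inequality loses nothing to first order in \<open>h\<close> and keeps the factor \<open>n + 1\<close>.
\<close>

lemma ln_det_ratio_le:
  fixes Q Q' :: "real^'n^'n" and b :: "'i \<Rightarrow> real^'n" and c h :: "real^'n"
  assumes Q: "pos_def Q" and Q': "pos_def Q'"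
    and I: "finite I" "\<And>i. i \<in> I \<Longrightarrow> 0 \<le> l i" "sum l I = 1"
    and mean: "(\<Sum>i\<in>I. l i *\<^sub>R b i) = c"
    and cov: "\<And>y. (\<Sum>i\<in>I. l i * ((b i - c) \<bullet> y)\<^sup>2) = (y \<bullet> (matrix_inv Q *v y)) / CARD('n)"
    and contact: "\<And>i. i \<in> I \<Longrightarrow> 0 < l i \<Longrightarrow> (b i - c) \<bullet> (Q *v (b i - c)) = 1"
    and r: "\<And>i. i \<in> I \<Longrightarrow> 0 < 1 - h \<bullet> b i"
    and Q'b: "\<And>i. i \<in> I \<Longrightarrow> b i \<bullet> (Q' *v b i) \<le> (1 - h \<bullet> b i)\<^sup>2"
  shows "ln (det Q') - ln (det Q) \<le> 2 * (CARD('n) + 1) * (\<Sum>i\<in>I. l i * ln (1 - h \<bullet> b i))"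
proof -
  define n where "n = real CARD('n)"
  have n: "n > 0" by (simp add: n_def)
  obtain B where B: "pos_def B" and BB: "B ** B = matrix_inv Q"
    using pos_def_sqrt [OF pos_def_matrix_inv [OF Q]] .
  note nzB = pos_def_det_nz [OF B] and nzQ = pos_def_det_nz [OF Q]
  \<comment> \<open>Whitening: \<open>B\<close> is the inverse square root of \<open>Q\<close>, and
    the factor \<open>sqrt n\<close> makes the weighted covariance of the \<open>\<zeta> i\<close>
    the identity. As their mean is zero, appending a coordinate 1 gives isotropic vectors
    \<open>w i\<close>, of squared norm \<open>n + 1\<close> wherever the weight is
    positive.\<close>
  define \<zeta> where "\<zeta> = (\<lambda>i. sqrt n *\<^sub>R (matrix_inv B *v (b i - c)))"
  define w where "w = (\<lambda>i. lift_vec (\<zeta> i) 1)"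
  \<comment> \<open>Read from the right: undo the whitening, translate by \<open>c\<close>, then
    shear the last coordinate from 1 to \<open>1 - h \<bullet> b i\<close>. Only the first factor
    affects the determinant.\<close>
  define G where "G = shear_mat (- (1 / sqrt n) *\<^sub>R h) ** transpose (shear_mat (sqrt n *\<^sub>R c)) ** lift_mat B"
  define S where "S = transpose G ** lift_mat Q' ** G"
  have symBi: "transpose (matrix_inv B) = matrix_inv B"
    by (rule pos_def_symmetric [OF pos_def_matrix_inv [OF B]])
  have detG: "det G = det B"
    by (simp add: G_def det_mul det_shear_mat det_lift_mat pos_def_symmetric [OF B])
  have S: "pos_def S"
    unfolding S_def by (rule pos_def_congruence) (simp_all add: pos_def_lift_mat Q' detG nzB)
  have "det S = det Q' * det (B ** B)"
    by (simp add: S_def det_mul detG det_lift_mat pos_def_symmetric [OF Q'])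
  then have "det S = det Q' / det Q"
    by (simp add: BB det_matrix_inv [OF nzQ])
  then have lnS: "ln (det S) = ln (det Q') - ln (det Q)"
    using pos_def_det [OF Q] pos_def_det [OF Q'] by (simp add: ln_div)
  have Gw: "G *v w i = lift_vec (sqrt n *\<^sub>R b i) (1 - h \<bullet> b i)" for i
  proof -
    have "B *v \<zeta> i = sqrt n *\<^sub>R (b i - c)"
      by (simp add: \<zeta>_def matrix_vector_mult_scaleR matrix_inv_cancel [OF nzB])
    then have "sqrt n *\<^sub>R c + B *v \<zeta> i = sqrt n *\<^sub>R b i"
      by (simp add: algebra_simps)
    then show ?thesis
      using n by (simp add: G_def w_def matrix_vector_mul_assoc [symmetric] lift_mat_vector
        transpose_shear_mat_vector shear_mat_vector add.commute del: transpose_matrix_vector)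
  qed
  have wSw: "w i \<bullet> (S *v w i) = n * (b i \<bullet> (Q' *v b i)) + (1 - h \<bullet> b i)\<^sup>2" for i
  proof -
    have "w i \<bullet> (S *v w i) = (G *v w i) \<bullet> (lift_mat Q' *v (G *v w i))"
      unfolding S_def
      by (simp add: matrix_vector_mul_assoc [symmetric])
        (metis dot_lmul_matrix inner_commute)
    also have "\<dots> = n * (b i \<bullet> (Q' *v b i)) + (1 - h \<bullet> b i)\<^sup>2"
      using n by (simp add: Gw lift_mat_vector inner_lift_vec matrix_vector_mult_scaleR power2_eq_square)
    finally show ?thesis .
  qed
  have \<zeta>y: "\<zeta> i \<bullet> y = sqrt n * ((b i - c) \<bullet> (matrix_inv B *v y))" for i y
    by (simp add: \<zeta>_def symmetric_inner [OF symBi])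
  have ww: "w i \<bullet> w i = n + 1" if "i \<in> I" "0 < l i" for i
  proof -
    have "Q ** (B ** B) = mat 1" by (simp add: BB matrix_inv_cancel [OF nzQ])
    then have "matrix_inv B *v (matrix_inv B *v y) = Q *v y" for y
      by (metis matrix_inv_cancel(3) [OF nzB] matrix_vector_mul_assoc matrix_vector_mul_lid matrix_mul_assoc)
    then have "\<zeta> i \<bullet> \<zeta> i = n * ((b i - c) \<bullet> (Q *v (b i - c)))"
      using n by (subst \<zeta>y) (simp add: \<zeta>_def matrix_vector_mult_scaleR)
    then show ?thesis using contact [OF that] by (simp add: w_def inner_lift_vec)
  qed
  have "(\<Sum>i\<in>I. l i *\<^sub>R (b i - c)) = 0"
    by (simp add: scaleR_right_diff_distrib sum_subtractf mean scaleR_left.sum [symmetric] I)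
  then have mean0: "(\<Sum>i\<in>I. l i * ((b i - c) \<bullet> y)) = 0" for y
    by (metis (mono_tags, lifting) inner_scaleR_left inner_sum_left inner_zero_left sum.cong)
  have iso: "(\<Sum>i\<in>I. l i * (w i \<bullet> y)\<^sup>2) = y \<bullet> y" for y
  proof -
    obtain z s where y: "y = lift_vec z s" by (rule lift_vec_cases)
    define z' where "z' = matrix_inv B *v z"
    have z: "z = B *v z'" by (simp add: z'_def matrix_inv_cancel [OF nzB])
    have "(\<Sum>i\<in>I. l i * (w i \<bullet> y)\<^sup>2) =
        (\<Sum>i\<in>I. n * (l i * ((b i - c) \<bullet> z')\<^sup>2) + 2 * s * sqrt n * (l i * ((b i - c) \<bullet> z')) + s\<^sup>2 * l i)"
    proof (rule sum.cong [OF refl])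
      fix i
      have "(w i \<bullet> y)\<^sup>2 = (sqrt n * ((b i - c) \<bullet> z') + s)\<^sup>2"
        by (simp add: w_def y inner_lift_vec \<zeta>y z'_def)
      also have "\<dots> = n * ((b i - c) \<bullet> z')\<^sup>2 + 2 * s * sqrt n * ((b i - c) \<bullet> z') + s\<^sup>2"
        using n by (simp add: power2_sum power_mult_distrib)
      finally show "l i * (w i \<bullet> y)\<^sup>2 = n * (l i * ((b i - c) \<bullet> z')\<^sup>2) + 2 * s * sqrt n * (l i * ((b i - c) \<bullet> z')) + s\<^sup>2 * l i"
        by (simp only: distrib_left mult.left_commute [of "l i"]) (simp only: mult_ac)
    qed
    also have "\<dots> = z' \<bullet> (matrix_inv Q *v z') + s\<^sup>2"
      using n by (simp add: sum.distrib sum_distrib_left [symmetric] mean0 cov I n_def [symmetric])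
    also have "z' \<bullet> (matrix_inv Q *v z') = z \<bullet> z"
      by (simp add: z BB [symmetric] matrix_vector_mul_assoc [symmetric] symmetric_inner [OF pos_def_symmetric [OF B]])
    finally show ?thesis by (simp add: y inner_lift_vec power2_eq_square)
  qed
  have "ln (det S) \<le> (\<Sum>i\<in>I. l i * ((w i \<bullet> w i) * ln ((w i \<bullet> (S *v w i)) / (w i \<bullet> w i))))"
    by (rule isotropic_jensen) (use I iso S in auto)
  also have "\<dots> \<le> (\<Sum>i\<in>I. l i * ((n + 1) * (2 * ln (1 - h \<bullet> b i))))"
  proof (rule sum_mono)
    fix i assume i: "i \<in> I"
    show "l i * ((w i \<bullet> w i) * ln ((w i \<bullet> (S *v w i)) / (w i \<bullet> w i))) \<le> l i * ((n + 1) * (2 * ln (1 - h \<bullet> b i)))"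
    \<comment> \<open>The norm of \<open>w i\<close> is known only for contact points, that is for
      positive weight; zero weights contribute nothing on either side.\<close>
    proof (cases "l i = 0")
      case False
      then have li: "0 < l i" using I i by (simp add: less_le)
      have "w i \<noteq> 0" by (simp add: w_def lift_vec_eq_0_iff)
      then have pos: "0 < w i \<bullet> (S *v w i)" using S by (simp add: pos_def_def)
      have "w i \<bullet> (S *v w i) \<le> (n + 1) * (1 - h \<bullet> b i)\<^sup>2"
        using mult_left_mono [OF Q'b [OF i], of n] n by (simp add: wSw algebra_simps)
      then have "(w i \<bullet> (S *v w i)) / (n + 1) \<le> (1 - h \<bullet> b i)\<^sup>2"
        using n by (simp add: divide_le_eq mult.commute)
      then have "ln ((w i \<bullet> (S *v w i)) / (n + 1)) \<le> ln ((1 - h \<bullet> b i)\<^sup>2)"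
        using pos n r [OF i] by (subst ln_le_cancel_iff) auto
      also have "\<dots> = 2 * ln (1 - h \<bullet> b i)"
        using r [OF i] by (simp add: ln_realpow)
      finally show ?thesis
        using li n by (simp add: ww [OF i li])
    qed simp
  qed
  also have "\<dots> = 2 * (CARD('n) + 1) * (\<Sum>i\<in>I. l i * ln (1 - h \<bullet> b i))"
    by (simp add: sum_distrib_left n_def algebra_simps)
  finally show ?thesis by (simp add: lnS)
qed

section \<open>John ellipsoids of finite sets\<close>

lemma matrix_sum_vector: "(\<Sum>i\<in>I. M i) *v y = (\<Sum>i\<in>I. M i *v (y :: real^'n))"
  by (induction I rule: infinite_finite_induct) (auto simp: matrix_vector_mult_add_rdistrib)

lemma trace_mult_sum:
  fixes A :: "real^'n^'n"
  shows "trace (A ** (\<Sum>i\<in>I. l i *\<^sub>R M i)) = (\<Sum>i\<in>I. l i * trace (A ** M i))"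
proof -
  have sc: "trace (c *\<^sub>R B) = c * trace B" for c and B :: "real^'n^'n"
    by (simp add: trace_def sum_distrib_left)
  show ?thesis
    by (induction I rule: infinite_finite_induct)
      (auto simp: matrix_add_ldistrib trace_add matrix_scaleR_right sc trace_0 [unfolded mat_0])
qed

lemma continuous_on_det [continuous_intros]:
  fixes f :: "'a::topological_space \<Rightarrow> real^'n^'n"
  assumes "continuous_on S f" shows "continuous_on S (\<lambda>x. det (f x))"
  unfolding det_def by (intro continuous_intros assms)

lemma continuous_on_outer [continuous_intros]:
  assumes "continuous_on S f" shows "continuous_on S (\<lambda>x. outer (f x))"
  unfolding outer_def by (intro continuous_intros assms)

text \<open>The weights \<open>l\<close> certify that \<open>ellipsoid c Q\<close> has minimal volume.\<close>

definition john_ellipsoid ::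
    "(real^'n) set \<Rightarrow> (real^'n \<Rightarrow> real) \<Rightarrow> real^'n \<Rightarrow> real^'n^'n \<Rightarrow> bool" where
  "john_ellipsoid S l c Q \<longleftrightarrow> finite S \<and> pos_def Q \<and> S \<subseteq> ellipsoid c Q \<and>
     (\<forall>p\<in>S. 0 \<le> l p) \<and> sum l S = 1 \<and> (\<Sum>p\<in>S. l p *\<^sub>R p) = c \<and>
     (\<Sum>p\<in>S. l p *\<^sub>R outer (p - c)) = (1 / CARD('n)) *\<^sub>R matrix_inv Q \<and>
     (\<forall>p\<in>S. 0 < l p \<longrightarrow> (p - c) \<bullet> (Q *v (p - c)) = 1)"

text \<open>Covariance is second moment minus the square of the mean. The moments depend linearly on
  the weights, so the covariance becomes a continuous function on a convex hull.\<close>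

lemma covariance_outer:
  fixes l :: "real^'n \<Rightarrow> real"
  assumes "sum l S = 1" and c: "(\<Sum>p\<in>S. l p *\<^sub>R p) = c"
  shows "(\<Sum>p\<in>S. l p *\<^sub>R outer (p - c)) = (\<Sum>p\<in>S. l p *\<^sub>R outer p) - outer c"
proof -
  have ci: "c $ i = (\<Sum>p\<in>S. l p * p $ i)" for i
    by (simp add: c [symmetric])
  have "(\<Sum>p\<in>S. l p *\<^sub>R outer (p - c)) $ i $ j = ((\<Sum>p\<in>S. l p *\<^sub>R outer p) - outer c) $ i $ j" for i j
  proof -
    have "(\<Sum>p\<in>S. l p *\<^sub>R outer (p - c)) $ i $ j =
        (\<Sum>p\<in>S. l p * (p $ i * p $ j) - (l p * p $ i) * c $ j - c $ i * (l p * p $ j) + l p * (c $ i * c $ j))"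
      by (simp add: outer_def algebra_simps)
    also have "\<dots> = (\<Sum>p\<in>S. l p * (p $ i * p $ j)) - c $ i * c $ j - c $ i * c $ j + sum l S * (c $ i * c $ j)"
      by (simp add: sum.distrib sum_subtractf sum_distrib_left [symmetric] sum_distrib_right [symmetric] ci [symmetric])
    finally show ?thesis by (simp add: outer_def assms)
  qed
  then show ?thesis by (simp add: vec_eq_iff)
qed

lemma covariance_form:
  "y \<bullet> ((\<Sum>p\<in>S. l p *\<^sub>R outer (p - c)) *v y) = (\<Sum>p\<in>S. l p * ((p - c) \<bullet> y)\<^sup>2)"
  by (simp add: matrix_sum_vector scaleR_matrix_vector_assoc [symmetric] outer_vector inner_sum_right
      power2_eq_square inner_commute mult.assoc)

lemma transpose_covariance:
  "transpose (\<Sum>p\<in>S. l p *\<^sub>R outer (p - c)) = (\<Sum>p\<in>S. l p *\<^sub>R outer (p - c))"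
  by (simp add: transpose_def vec_eq_iff outer_def mult.commute)

text \<open>
  Maximise the determinant of the covariance over all weights. Moving weight \<open>t\<close> to a point \<open>p\<close>
  is a rank-one change, multiplying it by \<open>(1 - t)\<^sup>n (1 + t d\<^sub>p)\<close> with \<open>d\<^sub>p\<close> the squared Mahalanobis
  distance, whence \<open>d\<^sub>p \<le> n\<close>.
\<close>

lemma exists_john_ellipsoid:
  fixes S :: "(real^'n) set"
  assumes S: "finite S" and nondeg: "\<And>y. y \<noteq> 0 \<Longrightarrow> \<exists>p\<in>S. \<exists>q\<in>S. p \<bullet> y \<noteq> q \<bullet> y"
  obtains l c Q where "john_ellipsoid S l c Q"
proof -
  define n where "n = real CARD('n)"
  have n: "n > 0" by (simp add: n_def)
  \<comment> \<open>Each point is paired with its second moment, so the moment pairs of all weights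
    form the convex hull of a finite set. The maximisation thus takes place on a compact convex
    set.\<close>
  define X where "X = (\<lambda>p :: real^'n. (p, outer p))"
  define C where "C = convex hull (X ` S)"
  define f where "f = (\<lambda>z :: (real^'n) \<times> (real^'n^'n). det (snd z - outer (fst z)))"
  have injX: "inj_on X S" by (auto simp: inj_on_def X_def)
  have C_iff: "z \<in> C \<longleftrightarrow> (\<exists>l. (\<forall>p\<in>S. 0 \<le> l p) \<and> sum l S = 1 \<and> z = (\<Sum>p\<in>S. l p *\<^sub>R X p))" for z
  proof
    assume "z \<in> C"
    then obtain u where "\<forall>x\<in>X ` S. 0 \<le> u x" "sum u (X ` S) = 1" "(\<Sum>x\<in>X ` S. u x *\<^sub>R x) = z"
      using S by (auto simp: C_def convex_hull_finite)
    then show "\<exists>l. (\<forall>p\<in>S. 0 \<le> l p) \<and> sum l S = 1 \<and> z = (\<Sum>p\<in>S. l p *\<^sub>R X p)"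
      using injX by (intro exI [of _ "u \<circ> X"]) (auto simp: sum.reindex o_def)
  next
    assume "\<exists>l. (\<forall>p\<in>S. 0 \<le> l p) \<and> sum l S = 1 \<and> z = (\<Sum>p\<in>S. l p *\<^sub>R X p)"
    then show "z \<in> C"
      unfolding C_def using S by (auto intro!: convex_sum convex_convex_hull intro: hull_inc)
  qed
  have "S \<noteq> {}" using nondeg [of "axis undefined 1"] by auto
  then have cardS: "card S > 0" using S by (simp add: card_gt_0_iff)
  have "compact C" unfolding C_def using S by (simp add: finite_imp_compact_convex_hull)
  moreover have "C \<noteq> {}" using \<open>S \<noteq> {}\<close> by (simp add: C_def)
  moreover have "continuous_on C f" unfolding f_def by (intro continuous_intros)
  ultimately obtain z where z: "z \<in> C" and zmax: "\<And>w. w \<in> C \<Longrightarrow> f w \<le> f z"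
    using continuous_attains_sup [of C f] by blast
  obtain l where l: "\<And>p. p \<in> S \<Longrightarrow> 0 \<le> l p" "sum l S = 1" and zl: "z = (\<Sum>p\<in>S. l p *\<^sub>R X p)"
    using z unfolding C_iff by blast
  define c where "c = (\<Sum>p\<in>S. l p *\<^sub>R p)"
  define V where "V = (\<Sum>p\<in>S. l p *\<^sub>R outer (p - c))"
  have zc: "z = (c, V + outer c)"
    using covariance_outer [of l S c] l by (simp add: zl X_def c_def V_def prod_eq_iff fst_sum snd_sum)
  have fz: "f z = det V" by (simp add: f_def zc)
  \<comment> \<open>Uniform weights already have a positive definite covariance, since no direction
    is constant on \<open>S\<close>; the maximal determinant is at least as large.\<close>
  have detV: "det V > 0"
  proof -
    define u where "u = (\<lambda>p :: real^'n. 1 / real (card S))"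
    define d where "d = (\<Sum>p\<in>S. u p *\<^sub>R p)"
    have u1: "sum u S = 1" using cardS by (simp add: u_def)
    have "\<forall>p\<in>S. 0 \<le> u p" by (simp add: u_def)
    then have "(\<Sum>p\<in>S. u p *\<^sub>R X p) \<in> C" unfolding C_iff using u1 by blast
    moreover have "f (\<Sum>p\<in>S. u p *\<^sub>R X p) = det (\<Sum>p\<in>S. u p *\<^sub>R outer (p - d))"
      using covariance_outer [OF u1 refl] by (simp add: f_def X_def d_def fst_sum snd_sum)
    moreover have "pos_def (\<Sum>p\<in>S. u p *\<^sub>R outer (p - d))"
      unfolding pos_def_def
    proof (intro conjI allI impI transpose_covariance)
      fix y :: "real^'n" assume "y \<noteq> 0"
      then obtain p q where pq: "p \<in> S" "q \<in> S" "p \<bullet> y \<noteq> q \<bullet> y" using nondeg by blast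
      then obtain p' where "p' \<in> S" "(p' - d) \<bullet> y \<noteq> 0"
        by (metis eq_iff_diff_eq_0 inner_diff_left)
      then show "0 < y \<bullet> ((\<Sum>p\<in>S. u p *\<^sub>R outer (p - d)) *v y)"
        unfolding covariance_form using S cardS
        by (intro sum_pos2 [of _ p']) (auto simp: u_def)
    qed
    ultimately show ?thesis using zmax pos_def_det fz by fastforce
  qed
  have V: "pos_def V"
    unfolding pos_def_def
  proof (intro conjI allI impI)
    show "transpose V = V" by (simp add: V_def transpose_covariance)
    fix y :: "real^'n" assume y: "y \<noteq> 0"
    have nn: "0 \<le> l p * ((p - c) \<bullet> y)\<^sup>2" if "p \<in> S" for p using l that by simp
    \<comment> \<open>A vanishing sum of nonnegative terms would put \<open>y\<close> into the
      kernel of \<open>V\<close>, against \<open>det V > 0\<close>.\<close>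
    have "(\<Sum>p\<in>S. l p * ((p - c) \<bullet> y)\<^sup>2) \<noteq> 0"
    proof
      assume "(\<Sum>p\<in>S. l p * ((p - c) \<bullet> y)\<^sup>2) = 0"
      then have "\<forall>p\<in>S. l p * ((p - c) \<bullet> y)\<^sup>2 = 0"
        using nn S by (simp add: sum_nonneg_eq_0_iff)
      then have "V *v y = 0"
        by (auto simp: V_def matrix_sum_vector scaleR_matrix_vector_assoc [symmetric] outer_vector intro!: sum.neutral)
      then show False using y matrix_inv_cancel(4) [of V y] detV by simp
    qed
    moreover have "0 \<le> (\<Sum>p\<in>S. l p * ((p - c) \<bullet> y)\<^sup>2)" by (intro sum_nonneg nn)
    ultimately show "0 < y \<bullet> (V *v y)"
      unfolding V_def covariance_form by linarith
  qed
  define d where "d = (\<lambda>p. (p - c) \<bullet> (matrix_inv V *v (p - c)))"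
  have d0: "0 \<le> d p" for p unfolding d_def by (rule pos_def_nonneg [OF pos_def_matrix_inv [OF V]])
  have dn: "d p \<le> n" if p: "p \<in> S" for p
  proof (rule ccontr)
    assume "\<not> d p \<le> n"
    then have dp: "d p > n" by simp
    have bound: "d p - n \<le> n * d p * t" if t: "0 < t" "t < 1" for t
    proof -
      have "(1 - t) *\<^sub>R z + t *\<^sub>R X p \<in> C"
        using z t p convex_convex_hull [of "X ` S"] unfolding C_def
        by (intro convexD) (auto intro: hull_inc)
      then have "f ((1 - t) *\<^sub>R z + t *\<^sub>R X p) \<le> det V" using zmax fz by simp
      \<comment> \<open>The mean moves along with the weights; the net effect on the covariance is a
        rank-one update scaled by \<open>1 - t\<close>.\<close>
      moreover have "f ((1 - t) *\<^sub>R z + t *\<^sub>R X p) = det ((1 - t) *\<^sub>R (V + t *\<^sub>R outer (p - c)))"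
        unfolding f_def
        by (rule arg_cong [where f=det]) (simp add: zc X_def outer_def vec_eq_iff algebra_simps)
      ultimately have "(1 - t) ^ CARD('n) * (det V * (1 + t * d p)) \<le> det V"
        by (simp add: det_scaleR det_add_outer [OF V] d_def)
      then have "det V * ((1 - t) ^ CARD('n) * (1 + t * d p)) \<le> det V * 1"
        by (simp add: algebra_simps)
      then have "(1 - t) ^ CARD('n) * (1 + t * d p) \<le> 1" using detV by simp
      \<comment> \<open>Bernoulli's inequality replaces the power by a linear factor, leaving a
        polynomial inequality that fails for small \<open>t\<close>.\<close>
      moreover have "(1 - n * t) * (1 + t * d p) \<le> (1 - t) ^ CARD('n) * (1 + t * d p)"
        using Bernoulli_inequality [of "- t" "CARD('n)"] t d0 [of p]
        by (intro mult_right_mono) (auto simp: n_def)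
      ultimately have "(1 - n * t) * (1 + t * d p) \<le> 1" by linarith
      then have "t * (d p - n) \<le> t * (n * d p * t)" by (simp add: algebra_simps)
      then show ?thesis using t by simp
    qed
    have nd: "n * d p > 0" using dp n by simp
    \<comment> \<open>This value turns the right side of \<open>bound\<close> into
      \<open>(d p - n) / 2\<close>, which is smaller than the left side.\<close>
    define t where "t = (d p - n) / (2 * (n * d p))"
    have "1 \<le> n" by (simp add: n_def Suc_leI)
    then have "d p \<le> n * d p" using mult_right_mono [of 1 n "d p"] d0 by simp
    then have "t < 1" unfolding t_def using nd n by (simp add: divide_less_eq)
    moreover have "0 < t" using nd dp by (simp add: t_def)
    ultimately have "d p - n \<le> n * d p * t" using bound by blast
    also have "\<dots> = (d p - n) / 2"
    proof -
      have "d p \<noteq> 0" "n \<noteq> 0" using nd by auto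
      then show ?thesis by (simp add: t_def)
    qed
    finally show False using dp by simp
  qed
  \<comment> \<open>The weighted mean of the distances is exactly \<open>n\<close>, while none
    exceeds \<open>n\<close>; hence each point of positive weight has distance \<open>n\<close> and
    lies on the boundary after scaling.\<close>
  have "(\<Sum>p\<in>S. l p * d p) = trace (matrix_inv V ** V)"
    by (subst (2) V_def) (simp add: trace_mult_sum trace_mult_outer d_def)
  also have "\<dots> = n" using detV by (simp add: matrix_inv_cancel trace_I n_def)
  finally have "(\<Sum>p\<in>S. l p * (n - d p)) = 0"
    by (simp add: right_diff_distrib sum_subtractf sum_distrib_right [symmetric] l)
  then have slack: "\<forall>p\<in>S. l p * (n - d p) = 0"
    using S l dn by (subst (asm) sum_nonneg_eq_0_iff) auto
  define Q where "Q = (1 / n) *\<^sub>R matrix_inv V"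
  have Q: "pos_def Q" unfolding Q_def using n by (simp add: pos_def_scaleR pos_def_matrix_inv V)
  have Qi: "matrix_inv Q = n *\<^sub>R V"
    unfolding Q_def using n detV by (subst matrix_inv_scaleR) (auto simp: det_matrix_inv matrix_inv_matrix_inv)
  have Qd: "(p - c) \<bullet> (Q *v (p - c)) = d p / n" for p
    by (simp add: Q_def d_def scaleR_matrix_vector_assoc [symmetric])
  have "john_ellipsoid S l c Q"
    unfolding john_ellipsoid_def
  proof (intro conjI ballI impI)
    show "S \<subseteq> ellipsoid c Q" using dn n by (auto simp: ellipsoid_def Qd)
    show "(\<Sum>p\<in>S. l p *\<^sub>R outer (p - c)) = (1 / CARD('n)) *\<^sub>R matrix_inv Q"
      using n by (simp add: Qi V_def [symmetric] n_def)
    fix p assume "p \<in> S" "0 < l p"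
    then show "(p - c) \<bullet> (Q *v (p - c)) = 1" using slack n by (auto simp: Qd)
  qed (use S Q l c_def in auto)
  then show ?thesis by (rule that)
qed

text \<open>Average the membership inequalities of the competitor over the weights. The mean and
  covariance conditions turn the average into a bound on the trace of
  \<open>Q' ** matrix_inv Q\<close> plus a penalty \<open>e\<close> for the shift of centre, and the
  trace bounds the log-determinants. Equality forces \<open>e = 0\<close> and equality in the trace
  inequality.\<close>

lemma john_ellipsoid_minimal:
  fixes S :: "(real^'n) set"
  assumes J: "john_ellipsoid S l c Q" and Q': "pos_def Q'" and sub: "S \<subseteq> ellipsoid c' Q'"
  shows "ln (det Q') \<le> ln (det Q)"
    and "ln (det Q') = ln (det Q) \<Longrightarrow> c' = c \<and> Q' = Q"
proof -
  define n where "n = real CARD('n)"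
  have n: "n > 0" by (simp add: n_def)
  have S: "finite S" and Q: "pos_def Q" and l: "\<And>p. p \<in> S \<Longrightarrow> 0 \<le> l p" "sum l S = 1"
    and c: "(\<Sum>p\<in>S. l p *\<^sub>R p) = c"
    and V: "(\<Sum>p\<in>S. l p *\<^sub>R outer (p - c)) = (1 / n) *\<^sub>R matrix_inv Q"
    using J by (auto simp: john_ellipsoid_def n_def)
  define e where "e = (c - c') \<bullet> (Q' *v (c - c'))"
  have symQ': "x \<bullet> (Q' *v y) = y \<bullet> (Q' *v x)" for x y
    by (metis pos_def_symmetric [OF Q'] symmetric_inner inner_commute)
  have "(\<Sum>p\<in>S. l p * ((p - c) \<bullet> (Q' *v (p - c)))) + e \<le> 1"
  proof -
    have "(\<Sum>p\<in>S. l p *\<^sub>R (p - c)) = 0"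
      by (simp add: scaleR_right_diff_distrib sum_subtractf c scaleR_left.sum [symmetric] l)
    then have mean0: "(\<Sum>p\<in>S. l p * ((p - c) \<bullet> y)) = 0" for y
      by (metis (mono_tags, lifting) inner_scaleR_left inner_sum_left inner_zero_left sum.cong)
    have "(\<Sum>p\<in>S. l p * ((p - c') \<bullet> (Q' *v (p - c')))) \<le> (\<Sum>p\<in>S. l p * 1)"
      using sub l by (intro sum_mono mult_left_mono) (auto simp: ellipsoid_def)
    moreover have "(\<Sum>p\<in>S. l p * ((p - c') \<bullet> (Q' *v (p - c')))) =
        (\<Sum>p\<in>S. l p * ((p - c) \<bullet> (Q' *v (p - c))) + 2 * (l p * ((p - c) \<bullet> (Q' *v (c - c')))) + l p * e)"
    proof (rule sum.cong [OF refl])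
      fix p
      have "p - c' = (p - c) + (c - c')" by simp
      then have "(p - c') \<bullet> (Q' *v (p - c')) =
          (p - c) \<bullet> (Q' *v (p - c)) + 2 * ((p - c) \<bullet> (Q' *v (c - c'))) + e"
        using symQ' [of "c - c'" "p - c"]
        by (simp only: matrix_vector_right_distrib inner_add_left inner_add_right e_def)
      then show "l p * ((p - c') \<bullet> (Q' *v (p - c'))) =
          l p * ((p - c) \<bullet> (Q' *v (p - c))) + 2 * (l p * ((p - c) \<bullet> (Q' *v (c - c')))) + l p * e"
        by (simp only: distrib_left mult.left_commute [of "l p"])
    qed
    ultimately show ?thesis
      by (simp add: sum.distrib sum_distrib_left [symmetric] sum_distrib_right [symmetric] mean0 l)
  qed
  moreover have "(\<Sum>p\<in>S. l p * ((p - c) \<bullet> (Q' *v (p - c)))) = trace (Q' ** ((1 / n) *\<^sub>R matrix_inv Q))"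
    by (simp add: V [symmetric] trace_mult_sum trace_mult_outer)
  moreover have "trace (Q' ** ((1 / n) *\<^sub>R matrix_inv Q)) = trace (Q' ** matrix_inv Q) / n"
    by (simp add: matrix_scaleR_right trace_def sum_divide_distrib)
  ultimately have tr: "trace (Q' ** matrix_inv Q) - n \<le> - n * e"
    using n by (simp add: field_simps)
  have e: "0 \<le> e" unfolding e_def by (rule pos_def_nonneg [OF Q'])
  have ld: "ln (det (matrix_inv Q)) = - ln (det Q)"
    using pos_def_det [OF Q] by (simp add: det_matrix_inv ln_div)
  note Qi = pos_def_matrix_inv [OF Q]
  have le: "ln (det Q') - ln (det Q) \<le> trace (Q' ** matrix_inv Q) - n"
    using ln_det_mult_le_trace(1) [OF Q' Qi] by (simp add: ld n_def)
  show "ln (det Q') \<le> ln (det Q)"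
    using le tr mult_nonneg_nonneg [OF less_imp_le [OF n] e] by linarith
  assume eq: "ln (det Q') = ln (det Q)"
  then have "n * e \<le> 0" using le tr by linarith
  then have "e = 0" using n e by (simp add: mult_le_0_iff)
  then have "c - c' = 0" using Q' unfolding e_def pos_def_def by (metis less_irrefl)
  moreover have "ln (det Q') + ln (det (matrix_inv Q)) = trace (Q' ** matrix_inv Q) - n"
    using eq le tr \<open>e = 0\<close> ld by simp
  then have "Q' = matrix_inv (matrix_inv Q)"
    using ln_det_mult_le_trace(2) [OF Q' Qi] by (simp add: n_def)
  ultimately show "c' = c \<and> Q' = Q"
    by (simp add: matrix_inv_matrix_inv pos_def_det_nz [OF Q])
qed

section \<open>The polarity step in a bounded polyhedron\<close>

lemma ellipsoid_subset_halfspace_polyhedron: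
  assumes E: "pos_def E"
  shows "ellipsoid y E \<subseteq> halfspace_polyhedron m a \<longleftrightarrow>
    (\<forall>i\<in>{1..m}. a i \<bullet> y + sqrt (a i \<bullet> (matrix_inv E *v a i)) \<le> 1)"
  unfolding ellipsoid_support [OF E, symmetric] by (auto simp: halfspace_polyhedron_def)

lemma mem_ellipsoid_translate: "x + y \<in> ellipsoid (x + c) Q \<longleftrightarrow> y \<in> ellipsoid c Q"
  by (simp add: ellipsoid_def)

text \<open>Separation made explicit: the outer normal \<open>g\<close> in direction
  \<open>k - c\<close>, divided by its support value, belongs to the polar. That value is positive
  because the origin is strictly inside. Testing \<open>k\<close> against it gives
  \<open>q \<le> sqrt q\<close>, so \<open>q \<le> 1\<close>.\<close>

lemma bipolar_ellipsoid:
  fixes Q :: "real^'n^'n"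
  assumes Q: "pos_def Q" and \<tau>: "c \<bullet> (Q *v c) < 1"
  shows "polar_set (polar_set (ellipsoid c Q)) \<subseteq> ellipsoid c Q"
proof
  fix k assume k: "k \<in> polar_set (polar_set (ellipsoid c Q))"
  define q where "q = (k - c) \<bullet> (Q *v (k - c))"
  show "k \<in> ellipsoid c Q"
  proof (cases "k = c")
    case True
    then show ?thesis by (simp add: ellipsoid_def)
  next
    case False
    then have q: "q > 0" using Q by (simp add: q_def pos_def_def)
    define g where "g = Q *v (k - c)"
    have gg: "g \<bullet> (matrix_inv Q *v g) = q"
      by (simp add: g_def q_def matrix_inv_cancel [OF pos_def_det_nz [OF Q]] inner_commute)
    have "(g \<bullet> c)\<^sup>2 \<le> q * (c \<bullet> (Q *v c))"
      using pos_def_cauchy_schwarz [OF Q, of g c] by (simp add: gg)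
    also have "\<dots> < q" using mult_strict_left_mono [OF \<tau> q] by simp
    finally have "\<bar>g \<bullet> c\<bar> < sqrt q"
      by (simp add: real_less_rsqrt)
    then have s: "0 < g \<bullet> c + sqrt q" by linarith
    have "(1 / (g \<bullet> c + sqrt q)) *\<^sub>R g \<in> polar_set (ellipsoid c Q)"
    proof -
      have "\<forall>s\<in>ellipsoid c Q. g \<bullet> s \<le> g \<bullet> c + sqrt q"
        by (simp add: ellipsoid_support [OF Q] gg)
      then show ?thesis using s by (simp add: polar_set_def)
    qed
    then have "k \<bullet> ((1 / (g \<bullet> c + sqrt q)) *\<^sub>R g) \<le> 1"
      using k unfolding polar_set_def [of "polar_set _"] by blast
    then have "k \<bullet> g \<le> g \<bullet> c + sqrt q" using s by simp
    moreover have "k \<bullet> g = g \<bullet> c + q" by (simp add: q_def g_def inner_diff_left inner_commute)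
    ultimately have "sqrt q * sqrt q \<le> sqrt q * 1" using q by simp
    then have "q \<le> 1" using q by (metis mult_le_cancel_left_pos real_sqrt_gt_0_iff real_sqrt_le_1_iff)
    then show ?thesis by (simp add: ellipsoid_def q_def)
  qed
qed

text \<open>The difference of the two sides has derivative \<open>(x - 1) * (1 / x - 1 / R)\<close>,
  which has the sign of \<open>x - 1\<close> up to \<open>R\<close>; so its minimum is its value 0
  at 1.\<close>

lemma ln_le_quadratic:
  fixes r R :: real
  assumes "0 < r" "r \<le> R" "1 \<le> R"
  shows "ln r \<le> (r - 1) - (r - 1)\<^sup>2 / (2 * R)"
proof -
  define g where "g = (\<lambda>r :: real. (r - 1) - (r - 1)\<^sup>2 / (2 * R) - ln r)"
  have deriv: "(g has_real_derivative (x - 1) * (1 / x - 1 / R)) (at x)" if "x > 0" for x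
    unfolding g_def using that assms
    by (auto intro!: derivative_eq_intros simp: field_simps power2_eq_square)
  have "g 1 \<le> g r"
  proof (cases "r \<le> 1")
    case True
    show ?thesis
    proof (rule DERIV_nonpos_imp_nonincreasing [OF True])
      fix x assume x: "r \<le> x" "x \<le> 1"
      then have "x > 0" "1 / x \<ge> 1 / R" using assms by (auto intro!: divide_left_mono)
      then show "\<exists>y. (g has_real_derivative y) (at x) \<and> y \<le> 0"
        using x by (intro exI [of _ "(x - 1) * (1 / x - 1 / R)"] conjI deriv mult_nonpos_nonneg) auto
    qed
  next
    case False
    then have "1 \<le> r" by simp
    then show ?thesis
    proof (rule DERIV_nonneg_imp_nondecreasing)
      fix x assume x: "1 \<le> x" "x \<le> r"
      then have "x > 0" "1 / x \<ge> 1 / R" using assms by (auto intro!: divide_left_mono)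
      then show "\<exists>y. (g has_real_derivative y) (at x) \<and> 0 \<le> y"
        using x by (intro exI [of _ "(x - 1) * (1 / x - 1 / R)"] conjI deriv mult_nonneg_nonneg) auto
    qed
  qed
  then show ?thesis by (simp add: g_def)
qed

section \<open>Normalised constraints and the minimum ellipsoid at an interior point\<close>

locale bounded_polyhedron =
  fixes a :: "nat \<Rightarrow> real^'n" and m :: nat and P :: "(real^'n) set"
  assumes P_def: "P = halfspace_polyhedron m a"
    and bounded: "bounded P"
begin

lemma mem_P: "x \<in> P \<longleftrightarrow> (\<forall>i\<in>{1..m}. a i \<bullet> x \<le> 1)"
  by (simp add: P_def halfspace_polyhedron_def)

lemma interior_P_iff: "x \<in> interior P \<longleftrightarrow> (\<forall>i\<in>{1..m}. a i \<bullet> x < 1)"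
proof
  assume x: "x \<in> interior P"
  show "\<forall>i\<in>{1..m}. a i \<bullet> x < 1"
  proof
    fix i assume i: "i \<in> {1..m}"
    obtain e where e: "e > 0" "cball x e \<subseteq> P"
      using x by (meson interior_subset mem_interior_cball)
    show "a i \<bullet> x < 1"
    proof (cases "a i = 0")
      case False
      have "x + (e / norm (a i)) *\<^sub>R a i \<in> P"
        using e False by (intro subsetD [OF e(2)]) (simp add: dist_norm)
      then have "a i \<bullet> x + (e / norm (a i)) * (a i \<bullet> a i) \<le> 1"
        using i by (auto simp: mem_P inner_add_right)
      moreover have "0 < (e / norm (a i)) * (a i \<bullet> a i)" using False e by simp
      ultimately show ?thesis by linarith
    qed simp
  qed
next
  assume "\<forall>i\<in>{1..m}. a i \<bullet> x < 1"
  then have "x \<in> (\<Inter>i\<in>{1..m}. {x. a i \<bullet> x < 1})" by simp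
  moreover have "open (\<Inter>i\<in>{1..m}. {x. a i \<bullet> x < 1})"
    by (intro open_INT ballI open_halfspace_lt) simp
  moreover have "(\<Inter>i\<in>{1..m}. {x. a i \<bullet> x < 1}) \<subseteq> P"
    by (force simp: mem_P intro: less_imp_le)
  ultimately show "x \<in> interior P" by (meson interiorI)
qed

text \<open>A nonzero such direction would give a ray from the origin inside \<open>P\<close>,
  against boundedness.\<close>

lemma recession_zero:
  assumes "\<And>i. i \<in> {1..m} \<Longrightarrow> a i \<bullet> d \<le> 0" shows "d = 0"
proof (rule ccontr)
  assume "d \<noteq> 0"
  obtain M where M: "\<And>x. x \<in> P \<Longrightarrow> norm x \<le> M" using bounded by (auto simp: bounded_iff)
  define t where "t = (\<bar>M\<bar> + 1) / norm d"
  have "t \<ge> 0" by (simp add: t_def)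
  then have "t *\<^sub>R d \<in> P"
    using assms by (auto simp: mem_P intro: order_trans [OF mult_nonneg_nonpos])
  then have "\<bar>M\<bar> + 1 \<le> M" using M [of "t *\<^sub>R d"] \<open>d \<noteq> 0\<close> by (simp add: t_def)
  then show False by linarith
qed

definition slack :: "real^'n \<Rightarrow> nat \<Rightarrow> real" where
  "slack x i = 1 - a i \<bullet> x"

lemma slack_pos: "x \<in> interior P \<Longrightarrow> i \<in> {1..m} \<Longrightarrow> 0 < slack x i"
  by (simp add: slack_def interior_P_iff)

text \<open>The constraints of \<open>P - x\<close> normalised to right-hand side 1. As a set it
  merges constraints with the same normalised vector, so weights are attached to points rather than
  to indices.\<close>

definition polar_points :: "real^'n \<Rightarrow> (real^'n) set" where
  "polar_points x = (\<lambda>i. (1 / slack x i) *\<^sub>R a i) ` {1..m}"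

text \<open>If all points had the same product with \<open>y\<close>, the numbers
  \<open>a i \<bullet> y\<close> would share a sign, since slacks are positive; then
  \<open>y\<close> or \<open>- y\<close> would be a recession direction.\<close>

lemma polar_points_nondegenerate:
  assumes x: "x \<in> interior P" and y: "y \<noteq> 0"
  shows "\<exists>p\<in>polar_points x. \<exists>q\<in>polar_points x. p \<bullet> y \<noteq> q \<bullet> y"
proof (rule ccontr)
  assume "\<not> ?thesis"
  then obtain \<kappa> where \<kappa>: "\<And>p. p \<in> polar_points x \<Longrightarrow> p \<bullet> y = \<kappa>" by blast
  have ai: "a i \<bullet> y = slack x i * \<kappa>" if "i \<in> {1..m}" for i
    using \<kappa> [of "(1 / slack x i) *\<^sub>R a i"] that slack_pos [OF x that]
    by (auto simp: polar_points_def field_simps)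
  show False
  proof (cases "\<kappa> \<le> 0")
    case True
    then have "y = 0"
      using ai slack_pos [OF x] by (intro recession_zero) (simp add: mult_nonneg_nonpos less_imp_le)
    then show False using y by simp
  next
    case False
    then have "- y = 0"
      using ai slack_pos [OF x] by (intro recession_zero) (simp add: less_imp_le)
    then show False using y by simp
  qed
qed

lemma polar_points_subset:
  assumes x: "x \<in> interior P"
  shows "polar_points x \<subseteq> polar_set ((\<lambda>p. p - x) ` P)"
proof
  fix p assume "p \<in> polar_points x"
  then obtain i where i: "i \<in> {1..m}" and p: "p = (1 / slack x i) *\<^sub>R a i"
    unfolding polar_points_def by blast
  have "p \<bullet> (z - x) \<le> 1" if "z \<in> P" for z
  proof -
    have "a i \<bullet> z \<le> 1" using that i mem_P by blast
    then have "a i \<bullet> (z - x) \<le> slack x i" by (simp add: slack_def inner_diff_right)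
    then show ?thesis
      using slack_pos [OF x i] by (simp add: p divide_le_eq)
  qed
  then show "p \<in> polar_set ((\<lambda>p. p - x) ` P)" by (simp add: polar_set_def)
qed

text \<open>If the origin were not strictly inside, expanding the membership of each point would
  make \<open>- (Q *v c)\<close> a recession direction, hence zero, which is absurd. The last claim
  follows from the second by taking polars again, and lets the finite set replace the whole
  polar.\<close>

lemma polar_points_in_ellipsoid:
  assumes x: "x \<in> interior P" and Q: "pos_def Q" and sub: "polar_points x \<subseteq> ellipsoid c Q"
  shows "c \<bullet> (Q *v c) < 1"
    and "y \<in> polar_set (ellipsoid c Q) \<Longrightarrow> x + y \<in> P"
    and "polar_set ((\<lambda>p. p - x) ` P) \<subseteq> ellipsoid c Q"
proof -
  have mem: "(1 / slack x i) *\<^sub>R a i \<in> ellipsoid c Q" if "i \<in> {1..m}" for i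
    using sub that by (auto simp: polar_points_def)
  show \<tau>: "c \<bullet> (Q *v c) < 1"
  proof (rule ccontr)
    assume \<tau>: "\<not> c \<bullet> (Q *v c) < 1"
    have "- (Q *v c) = 0"
    proof (rule recession_zero)
      fix i assume i: "i \<in> {1..m}"
      define p where "p = (1 / slack x i) *\<^sub>R a i"
      have "(p - c) \<bullet> (Q *v (p - c)) \<le> 1" using mem [OF i] by (simp add: p_def ellipsoid_def)
      moreover have "c \<bullet> (Q *v p) = p \<bullet> (Q *v c)"
        by (metis Q inner_commute pos_def_symmetric symmetric_inner)
      ultimately have "0 \<le> p \<bullet> (Q *v c)"
        using \<tau> pos_def_nonneg [OF Q, of p]
        by (simp add: matrix_vector_mult_diff_distrib inner_diff_left inner_diff_right)
      then show "a i \<bullet> - (Q *v c) \<le> 0"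
        using slack_pos [OF x i] by (simp add: p_def zero_le_divide_iff)
    qed
    then show False using \<tau> by simp
  qed
  show polar: "x + y \<in> P" if "y \<in> polar_set (ellipsoid c Q)" for y
    unfolding mem_P
  proof
    fix i assume i: "i \<in> {1..m}"
    then have "y \<bullet> ((1 / slack x i) *\<^sub>R a i) \<le> 1"
      using that mem unfolding polar_set_def by blast
    then show "a i \<bullet> (x + y) \<le> 1"
      using slack_pos [OF x i] by (simp add: inner_add_right inner_commute slack_def)
  qed
  show "polar_set ((\<lambda>p. p - x) ` P) \<subseteq> ellipsoid c Q"
  proof
    fix k assume k: "k \<in> polar_set ((\<lambda>p. p - x) ` P)"
    have "k \<bullet> y \<le> 1" if "y \<in> polar_set (ellipsoid c Q)" for y
    proof -
      have "k \<bullet> ((x + y) - x) \<le> 1" using k polar [OF that] by (auto simp: polar_set_def)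
      then show ?thesis by simp
    qed
    then have "k \<in> polar_set (polar_set (ellipsoid c Q))" by (simp add: polar_set_def)
    then show "k \<in> ellipsoid c Q" using bipolar_ellipsoid [OF Q \<tau>] by blast
  qed
qed

text \<open>Ellipsoids containing the polar and ellipsoids containing \<open>polar_points x\<close>
  are the same, so the John ellipsoid of the finite set is minimal for the polar as well; its
  uniqueness resolves the definite description in \<open>MinCE\<close>.\<close>

lemma polar_MinCE_john:
  assumes x: "x \<in> interior P"
  shows "polar_MinCE P x = ellipsoid (cvec P x) (Qmat P x) \<and>
    (\<exists>l. john_ellipsoid (polar_points x) l (cvec P x) (Qmat P x))"
proof -
  obtain l c Q where J: "john_ellipsoid (polar_points x) l c Q"
    by (rule exists_john_ellipsoid [of "polar_points x"])
      (use polar_points_nondegenerate [OF x] in \<open>auto simp: polar_points_def\<close>)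
  then have Q: "pos_def Q" and sub: "polar_points x \<subseteq> ellipsoid c Q"
    by (auto simp: john_ellipsoid_def)
  let ?K = "polar_set ((\<lambda>p. p - x) ` P)"
  have le: "Vol (ellipsoid c Q) \<le> Vol S'" if S': "is_ellipsoid S'" "?K \<subseteq> S'" for S'
  proof -
    obtain c' Q' where "pos_def Q'" "S' = ellipsoid c' Q'" using S' by (auto simp: is_ellipsoid_def)
    moreover from this have "polar_points x \<subseteq> ellipsoid c' Q'"
      using S' polar_points_subset [OF x] by blast
    ultimately show ?thesis
      using john_ellipsoid_minimal(1) [OF J] by (simp add: Vol_ellipsoid_le_iff Q)
  qed
  have "MinCE ?K = ellipsoid c Q"
    unfolding MinCE_def
  proof (rule the_equality)
    show "is_ellipsoid (ellipsoid c Q) \<and> ?K \<subseteq> ellipsoid c Q \<and>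
        (\<forall>S'. is_ellipsoid S' \<and> ?K \<subseteq> S' \<longrightarrow> Vol (ellipsoid c Q) \<le> Vol S')"
      using Q polar_points_in_ellipsoid(3) [OF x Q sub] le by (auto simp: is_ellipsoid_def)
    fix S assume S: "is_ellipsoid S \<and> ?K \<subseteq> S \<and> (\<forall>S'. is_ellipsoid S' \<and> ?K \<subseteq> S' \<longrightarrow> Vol S \<le> Vol S')"
    then obtain c' Q' where Q': "pos_def Q'" "S = ellipsoid c' Q'" by (auto simp: is_ellipsoid_def)
    then have sub': "polar_points x \<subseteq> ellipsoid c' Q'"
      using S polar_points_subset [OF x] by blast
    have "Vol S \<le> Vol (ellipsoid c Q)"
    proof -
      have "is_ellipsoid (ellipsoid c Q)" using Q by (auto simp: is_ellipsoid_def)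
      then show ?thesis using S polar_points_in_ellipsoid(3) [OF x Q sub] by blast
    qed
    then have "ln (det Q) \<le> ln (det Q')" using Q Q' by (simp add: Vol_ellipsoid_le_iff)
    then show "S = ellipsoid c Q"
      using john_ellipsoid_minimal [OF J Q'(1) sub'] Q' by auto
  qed
  then have "polar_MinCE P x = ellipsoid c Q" by (simp add: polar_MinCE_def)
  moreover from this have "cvec P x = c" "Qmat P x = Q"
    by (simp_all add: cvec_def Qmat_def center_ellipsoid shape_ellipsoid Q)
  ultimately show ?thesis using J by auto
qed

lemma
  assumes x: "x \<in> interior P"
  shows pos_def_Qmat: "pos_def (Qmat P x)"
    and polar_points_in_MinCE: "polar_points x \<subseteq> ellipsoid (cvec P x) (Qmat P x)"
    and vfun_eq: "vfun P x = - ln (det (Qmat P x)) / 2"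
    and tau_less_1: "tau P x < 1"
    and tau_nonneg: "0 \<le> tau P x"
proof -
  show 1: "pos_def (Qmat P x)" and 2: "polar_points x \<subseteq> ellipsoid (cvec P x) (Qmat P x)"
    using polar_MinCE_john [OF x] by (auto simp: john_ellipsoid_def)
  show "vfun P x = - ln (det (Qmat P x)) / 2"
    using polar_MinCE_john [OF x] 1 by (simp add: vfun_def ln_Vol_ellipsoid)
  show "tau P x < 1" "0 \<le> tau P x"
    using polar_points_in_ellipsoid(1) [OF x 1 2] pos_def_nonneg [OF 1] by (simp_all add: tau_def)
qed

section \<open>One polarity step: inscribed ellipsoid, descent and gap\<close>

definition next_center :: "real^'n \<Rightarrow> real^'n" where
  "next_center x = x - (1 / (1 - tau P x)) *\<^sub>R (Qmat P x *v cvec P x)"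

definition next_shape :: "real^'n \<Rightarrow> real^'n^'n" where
  "next_shape x = (1 - tau P x) *\<^sub>R (matrix_inv (Qmat P x) - outer (cvec P x))"

text \<open>The polar formula, translated back by \<open>x\<close>. The determinant identity says
  that the inscribed log-volume exceeds \<open>- vfun P x\<close> by a nonnegative amount governed
  by \<open>tau P x\<close>.\<close>

lemma
  assumes x: "x \<in> interior P"
  shows pos_def_next_shape: "pos_def (next_shape x)"
    and polar_polar_MinCE: "polar_set (polar_MinCE P x) = ellipsoid (next_center x - x) (next_shape x)"
    and next_ellipsoid_subset: "ellipsoid (next_center x) (next_shape x) \<subseteq> P"
    and ln_det_next_shape: "ln (det (next_shape x)) = (CARD('n) + 1) * ln (1 - tau P x) + 2 * vfun P x"
proof -
  note Q = pos_def_Qmat [OF x]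
  have \<tau>: "cvec P x \<bullet> (Qmat P x *v cvec P x) < 1"
    using tau_less_1 [OF x] by (simp add: tau_def)
  show "pos_def (next_shape x)"
    unfolding next_shape_def using \<tau>
    by (intro pos_def_scaleR pos_def_inv_diff_outer [OF Q]) (auto simp: tau_def)
  show eq: "polar_set (polar_MinCE P x) = ellipsoid (next_center x - x) (next_shape x)"
    using polar_ellipsoid [OF Q \<tau>] polar_MinCE_john [OF x]
    by (simp add: next_center_def next_shape_def tau_def)
  show "ellipsoid (next_center x) (next_shape x) \<subseteq> P"
  proof
    fix z assume "z \<in> ellipsoid (next_center x) (next_shape x)"
    then have "z - x \<in> polar_set (polar_MinCE P x)"
      using mem_ellipsoid_translate [of x "z - x" "next_center x - x"] by (simp add: eq)
    then show "z \<in> P"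
      using polar_points_in_ellipsoid(2) [OF x Q polar_points_in_MinCE [OF x], of "z - x"]
        polar_MinCE_john [OF x] by simp
  qed
  have "det (next_shape x) = (1 - tau P x) ^ (CARD('n) + 1) / det (Qmat P x)"
    using det_polar_shape [OF Q \<tau>] by (simp add: next_shape_def tau_def)
  then have "ln (det (next_shape x)) = ln ((1 - tau P x) ^ (CARD('n) + 1)) - ln (det (Qmat P x))"
    using tau_less_1 [OF x] pos_def_det [OF Q] by (simp add: ln_div del: power_Suc)
  then show "ln (det (next_shape x)) = (CARD('n) + 1) * ln (1 - tau P x) + 2 * vfun P x"
    using tau_less_1 [OF x] by (simp add: ln_realpow vfun_eq [OF x] del: power_Suc)
qed

text \<open>About its own centre the polar of the ellipsoid is
  \<open>ellipsoid 0 (matrix_inv E)\<close>, which contains the polar points at \<open>y\<close> and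
  so competes with the minimum ellipsoid there. The last claim is the uniqueness of the
  minimiser.\<close>

lemma inscribed_ellipsoid:
  assumes E: "pos_def E" and sub: "ellipsoid y E \<subseteq> P"
  shows "y \<in> interior P" and "vfun P y \<le> ln (det E) / 2"
    and "vfun P y = ln (det E) / 2 \<Longrightarrow> cvec P y = 0 \<and> Qmat P y = matrix_inv E"
proof -
  note Ei = pos_def_matrix_inv [OF E]
  have le: "sqrt (a i \<bullet> (matrix_inv E *v a i)) \<le> slack y i" if "i \<in> {1..m}" for i
    using sub that unfolding P_def ellipsoid_subset_halfspace_polyhedron [OF E] slack_def by fastforce
  have "0 < slack y i" if i: "i \<in> {1..m}" for i
  proof (cases "a i = 0")
    case False
    then have "0 < sqrt (a i \<bullet> (matrix_inv E *v a i))" using Ei by (simp add: pos_def_def)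
    then show ?thesis using le [OF i] by linarith
  qed (simp add: slack_def)
  then show y: "y \<in> interior P" by (auto simp: interior_P_iff slack_def)
  have "polar_points y \<subseteq> ellipsoid 0 (matrix_inv E)"
  proof
    fix p assume "p \<in> polar_points y"
    then obtain i where i: "i \<in> {1..m}" and p: "p = (1 / slack y i) *\<^sub>R a i"
      by (auto simp: polar_points_def)
    have "a i \<bullet> (matrix_inv E *v a i) \<le> (slack y i)\<^sup>2"
      using le [OF i] by (rule sqrt_le_D)
    then show "p \<in> ellipsoid 0 (matrix_inv E)"
      using slack_pos [OF y i]
      by (simp add: p ellipsoid_def matrix_vector_mult_scaleR divide_le_eq power2_eq_square)
  qed
  moreover obtain l where J: "john_ellipsoid (polar_points y) l (cvec P y) (Qmat P y)"
    using polar_MinCE_john [OF y] by blast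
  ultimately have min: "ln (det (matrix_inv E)) \<le> ln (det (Qmat P y))"
      "ln (det (matrix_inv E)) = ln (det (Qmat P y)) \<Longrightarrow> 0 = cvec P y \<and> matrix_inv E = Qmat P y"
    using john_ellipsoid_minimal [OF J Ei] by blast+
  have ld: "ln (det (matrix_inv E)) = - ln (det E)"
    using pos_def_det [OF E] by (simp add: det_matrix_inv ln_div)
  show "vfun P y \<le> ln (det E) / 2"
    using min(1) unfolding ld vfun_eq [OF y] by linarith
  assume "vfun P y = ln (det E) / 2"
  then have "ln (det (matrix_inv E)) = ln (det (Qmat P y))"
    unfolding ld vfun_eq [OF y] by linarith
  then show "cvec P y = 0 \<and> Qmat P y = matrix_inv E" using min(2) by auto
qed

text \<open>The new point is the centre of an inscribed ellipsoid, so its value is at most half the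
  log-determinant of that shape; \<open>ln (1 - tau P x) \<le> - tau P x\<close> makes the gain
  linear.\<close>

lemma
  assumes x: "x \<in> interior P"
  shows next_center_interior: "next_center x \<in> interior P"
    and vfun_next_center: "vfun P (next_center x) \<le> vfun P x - (CARD('n) + 1) / 2 * tau P x"
proof -
  note ins = inscribed_ellipsoid [OF pos_def_next_shape [OF x] next_ellipsoid_subset [OF x]]
  show "next_center x \<in> interior P" by (rule ins)
  have "ln (1 - tau P x) \<le> - tau P x"
    using ln_le_minus_one [of "1 - tau P x"] tau_less_1 [OF x] by simp
  then have "(CARD('n) + 1) * ln (1 - tau P x) \<le> (CARD('n) + 1) * (- tau P x)"
    by (intro mult_left_mono) auto
  then show "vfun P (next_center x) \<le> vfun P x - (CARD('n) + 1) / 2 * tau P x"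
    using ins(2) by (simp add: ln_det_next_shape [OF x] field_simps)
qed

text \<open>Since \<open>cvec P y = 0\<close>, the minimum ellipsoid at \<open>y\<close> is centred
  at the origin and \<open>Qmat P y\<close> can serve as \<open>Q'\<close> in the lifted determinant
  bound. The constant \<open>R\<close> keeps the arguments of the logarithm in the range of the
  quadratic estimate.\<close>

lemma vfun_gap:
  fixes R :: real
  assumes x: "x \<in> interior P" and y: "y \<in> interior P" and cy: "cvec P y = 0"
    and R: "1 \<le> R" "\<And>i. i \<in> {1..m} \<Longrightarrow> slack y i \<le> R * slack x i"
  shows "vfun P x - vfun P y \<le> (CARD('n) + 1) *
    (- (cvec P x \<bullet> (y - x)) - ((y - x) \<bullet> (matrix_inv (Qmat P x) *v (y - x))) / (2 * R * CARD('n)))"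
proof -
  define n where "n = real CARD('n)"
  define h where "h = y - x"
  define c where "c = cvec P x"
  define S where "S = polar_points x"
  define q where "q = (h \<bullet> (matrix_inv (Qmat P x) *v h)) / n"
  have n: "n > 0" by (simp add: n_def)
  obtain l where J: "john_ellipsoid S l c (Qmat P x)"
    using polar_MinCE_john [OF x] by (auto simp: S_def c_def)
  then have S: "finite S" and l: "\<And>p. p \<in> S \<Longrightarrow> 0 \<le> l p" "sum l S = 1"
    and mean: "(\<Sum>p\<in>S. l p *\<^sub>R p) = c"
    and contact: "\<And>p. p \<in> S \<Longrightarrow> 0 < l p \<Longrightarrow> (p - c) \<bullet> (Qmat P x *v (p - c)) = 1"
    by (auto simp: john_ellipsoid_def)
  have "(\<Sum>p\<in>S. l p *\<^sub>R outer (p - c)) = (1 / n) *\<^sub>R matrix_inv (Qmat P x)"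
    using J by (simp add: john_ellipsoid_def n_def)
  then have cov: "(\<Sum>p\<in>S. l p * ((p - c) \<bullet> z)\<^sup>2) = (z \<bullet> (matrix_inv (Qmat P x) *v z)) / n" for z
    by (simp add: covariance_form [symmetric] scaleR_matrix_vector_assoc [symmetric])
  \<comment> \<open>The factor \<open>1 - h \<bullet> p\<close> is the ratio of the slacks at
    \<open>y\<close> and \<open>x\<close>; dividing \<open>p\<close> by it gives the polar point of
    the same constraint at \<open>y\<close>.\<close>
  have ratio: "\<exists>i\<in>{1..m}. p = (1 / slack x i) *\<^sub>R a i \<and> 1 - h \<bullet> p = slack y i / slack x i"
    if p: "p \<in> S" for p
  proof -
    obtain i where i: "i \<in> {1..m}" and p: "p = (1 / slack x i) *\<^sub>R a i"
      using p unfolding S_def polar_points_def by blast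
    have "1 - h \<bullet> p = slack y i / slack x i"
      using slack_pos [OF x i]
      by (simp add: p h_def field_simps inner_diff_left) (simp add: slack_def inner_commute)
    then show ?thesis using i p by blast
  qed
  have rpos: "0 < 1 - h \<bullet> p" if p: "p \<in> S" for p
  proof -
    obtain i where "i \<in> {1..m}" "1 - h \<bullet> p = slack y i / slack x i" using ratio [OF p] by blast
    then show ?thesis using slack_pos [OF x] slack_pos [OF y] by (metis divide_pos_pos)
  qed
  have rR: "1 - h \<bullet> p \<le> R" if p: "p \<in> S" for p
  proof -
    obtain i where i: "i \<in> {1..m}" and "1 - h \<bullet> p = slack y i / slack x i" using ratio [OF p] by blast
    then show ?thesis using slack_pos [OF x i] R(2) [OF i] by (metis pos_divide_le_eq)
  qed
  have "p \<bullet> (Qmat P y *v p) \<le> (1 - h \<bullet> p)\<^sup>2" if p: "p \<in> S" for p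
  proof -
    obtain i where i: "i \<in> {1..m}" and p: "p = (1 / slack x i) *\<^sub>R a i"
      and r: "1 - h \<bullet> p = slack y i / slack x i" using ratio [OF p] by blast
    have "(1 / slack y i) *\<^sub>R a i \<in> ellipsoid 0 (Qmat P y)"
      using polar_points_in_MinCE [OF y] i by (auto simp: cy polar_points_def)
    then have "a i \<bullet> (Qmat P y *v a i) \<le> (slack y i)\<^sup>2"
      using slack_pos [OF y i]
      by (simp add: ellipsoid_def matrix_vector_mult_scaleR divide_le_eq power2_eq_square)
    then show ?thesis
      unfolding r using slack_pos [OF x i]
      by (simp add: p matrix_vector_mult_scaleR power_divide divide_right_mono power2_eq_square)
  qed
  then have "ln (det (Qmat P y)) - ln (det (Qmat P x))
      \<le> 2 * (CARD('n) + 1) * (\<Sum>p\<in>S. l p * ln (1 - h \<bullet> p))"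
    using ln_det_ratio_le [OF pos_def_Qmat [OF x] pos_def_Qmat [OF y] S l, of "\<lambda>p. p" c h]
      mean cov contact rpos by (simp add: n_def)
  then have "vfun P x - vfun P y \<le> (CARD('n) + 1) * (\<Sum>p\<in>S. l p * ln (1 - h \<bullet> p))"
    by (simp add: vfun_eq x y algebra_simps)
  also have "\<dots> \<le> (CARD('n) + 1) * (- (c \<bullet> h) - q / (2 * R))"
  proof (rule mult_left_mono)
    have "(\<Sum>p\<in>S. l p * ln (1 - h \<bullet> p)) \<le> (\<Sum>p\<in>S. l p * (- (h \<bullet> p) - (h \<bullet> p)\<^sup>2 / (2 * R)))"
    proof (intro sum_mono mult_left_mono l)
      fix p assume p: "p \<in> S"
      show "ln (1 - h \<bullet> p) \<le> - (h \<bullet> p) - (h \<bullet> p)\<^sup>2 / (2 * R)"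
        using ln_le_quadratic [OF rpos [OF p] rR [OF p] R(1)] by simp
    qed
    also have "\<dots> = - (\<Sum>p\<in>S. l p * (h \<bullet> p)) - (\<Sum>p\<in>S. l p * (h \<bullet> p)\<^sup>2) / (2 * R)"
      by (simp add: right_diff_distrib sum_subtractf sum_negf sum_divide_distrib)
    also have "(\<Sum>p\<in>S. l p * (h \<bullet> p)) = c \<bullet> h"
      by (simp add: mean [symmetric] inner_sum_left) (simp add: inner_commute)
    finally have le: "(\<Sum>p\<in>S. l p * ln (1 - h \<bullet> p)) \<le> - (c \<bullet> h) - (\<Sum>p\<in>S. l p * (h \<bullet> p)\<^sup>2) / (2 * R)" .
    \<comment> \<open>The logarithm yields second moments about the origin; they exceed the
      covariance term \<open>q\<close> by the square of \<open>c \<bullet> h\<close>, which is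
      dropped.\<close>
    have "(\<Sum>p\<in>S. l p *\<^sub>R outer p) = (\<Sum>p\<in>S. l p *\<^sub>R outer (p - c)) + outer c"
      using covariance_outer [OF l(2) mean] by simp
    then have "h \<bullet> ((\<Sum>p\<in>S. l p *\<^sub>R outer p) *v h) = q + (c \<bullet> h)\<^sup>2"
      by (simp add: matrix_vector_mult_add_rdistrib inner_add_right covariance_form cov q_def
          outer_vector) (simp add: power2_eq_square inner_commute)
    then have "q + (c \<bullet> h)\<^sup>2 = (\<Sum>p\<in>S. l p * (h \<bullet> p)\<^sup>2)"
      using covariance_form [of h l 0 S] by (simp add: inner_commute)
    then have "q \<le> (\<Sum>p\<in>S. l p * (h \<bullet> p)\<^sup>2)"
      using zero_le_power2 [of "c \<bullet> h"] by linarith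
    then have "q / (2 * R) \<le> (\<Sum>p\<in>S. l p * (h \<bullet> p)\<^sup>2) / (2 * R)"
      using R by (intro divide_right_mono) auto
    then show "(\<Sum>p\<in>S. l p * ln (1 - h \<bullet> p)) \<le> - (c \<bullet> h) - q / (2 * R)"
      using le by linarith
  qed simp
  finally show ?thesis by (simp add: h_def c_def q_def n_def mult.commute)
qed

end

section \<open>Maximal inscribed ellipsoids and convergence\<close>

lemma continuous_on_matrix_mult [continuous_intros]:
  fixes f :: "'a::topological_space \<Rightarrow> real^'n^'m" and g :: "'a \<Rightarrow> real^'k^'n"
  assumes "continuous_on S f" "continuous_on S g" shows "continuous_on S (\<lambda>x. f x ** g x)"
  unfolding matrix_matrix_mult_def by (intro continuous_intros assms)

lemma continuous_on_transpose [continuous_intros]: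
  fixes f :: "'a::topological_space \<Rightarrow> real^'n^'m"
  assumes "continuous_on S f" shows "continuous_on S (\<lambda>x. transpose (f x))"
  unfolding transpose_def by (intro continuous_intros assms)

lemma continuous_on_matrix_vector [continuous_intros]:
  fixes f :: "'a::topological_space \<Rightarrow> real^'n^'m" and g :: "'a \<Rightarrow> real^'n"
  assumes "continuous_on S f" "continuous_on S g" shows "continuous_on S (\<lambda>x. f x *v g x)"
  unfolding matrix_vector_mult_def by (intro continuous_intros assms)

text \<open>Cramer's rule writes the entries as quotients of determinants, from which continuity of
  inversion is read off.\<close>

lemma matrix_inv_cramer:
  fixes A :: "real^'n^'n"
  assumes "det A \<noteq> 0"
  shows "matrix_inv A $ i $ j = det (\<chi> p q. if q = i then axis j 1 $ p else A $ p $ q) / det A"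
proof -
  have "A *v (matrix_inv A *v axis j 1) = axis j 1" by (rule matrix_inv_cancel [OF assms])
  then have "matrix_inv A *v axis j 1 = (\<chi> i. det (\<chi> p q. if q = i then axis j 1 $ p else A $ p $ q) / det A)"
    by (simp add: cramer [OF assms])
  then have "(matrix_inv A *v axis j 1) $ i = det (\<chi> p q. if q = i then axis j 1 $ p else A $ p $ q) / det A"
    by simp
  then show ?thesis by (simp add: matrix_vector_mult_basis column_def)
qed

lemma continuous_on_matrix_inv:
  fixes f :: "'a::topological_space \<Rightarrow> real^'n^'n"
  assumes f: "continuous_on S f" and nz: "\<And>x. x \<in> S \<Longrightarrow> det (f x) \<noteq> 0"
  shows "continuous_on S (\<lambda>x. matrix_inv (f x))"
proof -
  have "continuous_on S (\<lambda>x. if q = i then axis j 1 $ p else f x $ p $ q)" for i j p q :: 'n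
    by (cases "q = i") (auto intro!: continuous_intros f)
  then have "continuous_on S (\<lambda>x. \<chi> i j.
      det (\<chi> p q. if q = i then axis j 1 $ p else f x $ p $ q) / det (f x))"
    using nz by (intro continuous_intros f) auto
  moreover have "matrix_inv (f x) = (\<chi> i j.
      det (\<chi> p q. if q = i then axis j 1 $ p else f x $ p $ q) / det (f x))" if "x \<in> S" for x
    using matrix_inv_cramer [OF nz [OF that]] by (simp add: vec_eq_iff)
  ultimately show ?thesis by (simp cong: continuous_on_cong)
qed

text \<open>Where \<open>g\<close> stays at distance \<open>e\<close> from \<open>L\<close>, a
  compact set, the function \<open>f\<close> is bounded away from \<open>M\<close>. Uniqueness is
  asked only of the value of \<open>g\<close>: different factors \<open>B\<close> may describe the
  same ellipsoid.\<close>

lemma compact_level_tendsto: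
  fixes f :: "'a::t2_space \<Rightarrow> real" and g :: "'a \<Rightarrow> 'b::metric_space"
  assumes K: "compact K" and f: "continuous_on K f" and g: "continuous_on K g"
    and uniq: "\<And>z. z \<in> K \<Longrightarrow> f z = M \<Longrightarrow> g z = L"
    and z: "\<And>k :: nat. z k \<in> K" and lim: "(\<lambda>k. f (z k)) \<longlonglongrightarrow> M"
  shows "(\<lambda>k. g (z k)) \<longlonglongrightarrow> L"
proof (rule tendstoI)
  fix e :: real assume e: "e > 0"
  define K' where "K' = {z \<in> K. e \<le> dist (g z) L}"
  have "K' = K \<inter> (\<lambda>z. dist (g z) L) -` {e..}" by (auto simp: K'_def)
  moreover have "closedin (top_of_set K) (K \<inter> (\<lambda>z. dist (g z) L) -` {e..})"
    by (intro continuous_closedin_preimage continuous_intros g)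
  ultimately have "compact K'" using K closedin_compact by metis
  show "\<forall>\<^sub>F k in sequentially. dist (g (z k)) L < e"
  proof (cases "K' = {}")
    case True
    have "dist (g (z k)) L < e" for k
    proof -
      have "z k \<notin> K'" using True by simp
      then show ?thesis using z by (simp add: K'_def)
    qed
    then show ?thesis by simp
  next
    case False
    have "continuous_on K' (\<lambda>z. \<bar>f z - M\<bar>)"
      by (intro continuous_intros continuous_on_subset [OF f]) (auto simp: K'_def)
    then obtain w where w: "w \<in> K'" and wmin: "\<And>z. z \<in> K' \<Longrightarrow> \<bar>f w - M\<bar> \<le> \<bar>f z - M\<bar>"
      using continuous_attains_inf [OF \<open>compact K'\<close> False] by blast
    have "g w \<noteq> L" using w e by (auto simp: K'_def)
    then have "f w \<noteq> M" using uniq w by (auto simp: K'_def)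
    then have "\<forall>\<^sub>F k in sequentially. dist (f (z k)) M < \<bar>f w - M\<bar>"
      by (intro tendstoD [OF lim]) simp
    then show ?thesis
    proof (rule eventually_mono)
      fix k assume "dist (f (z k)) M < \<bar>f w - M\<bar>"
      then have "z k \<notin> K'" using wmin by (force simp: dist_real_def)
      then show "dist (g (z k)) L < e" using z by (auto simp: K'_def)
    qed
  qed
qed

section \<open>A compact parametrisation of inscribed ellipsoids\<close>

context bounded_polyhedron
begin

text \<open>
  A pair \<open>(x, B)\<close> stands for the image of the unit ball under \<open>y \<mapsto> x + B y\<close>, which is
  \<open>ellipsoid x ((B B\<^sup>T)\<^sup>-\<^sup>1)\<close> once \<open>det B \<noteq> 0\<close>.
\<close>

definition inscribed :: "real \<Rightarrow> ((real^'n) \<times> (real^'n^'n)) set" where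
  "inscribed V = {z. (\<forall>i\<in>{1..m}. a i \<bullet> fst z + norm (transpose (snd z) *v a i) \<le> 1) \<and> V \<le> \<bar>det (snd z)\<bar>}"

text \<open>Closedness is immediate from continuity. For boundedness, \<open>x\<close> and each
  \<open>x + B *v axis j 1\<close> lie in \<open>P\<close>, so the columns of \<open>B\<close> are
  differences of points of \<open>P\<close>.\<close>

lemma compact_inscribed: "compact (inscribed V)"
proof -
  have "closed {z :: (real^'n) \<times> (real^'n^'n). a i \<bullet> fst z + norm (transpose (snd z) *v a i) \<le> 1}" for i
    by (intro closed_Collect_le continuous_intros)
  moreover have "closed {z :: (real^'n) \<times> (real^'n^'n). V \<le> \<bar>det (snd z)\<bar>}"
    by (intro closed_Collect_le continuous_intros)
  moreover have "inscribed V = (\<Inter>i\<in>{1..m}. {z. a i \<bullet> fst z + norm (transpose (snd z) *v a i) \<le> 1})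
      \<inter> {z. V \<le> \<bar>det (snd z)\<bar>}"
    by (auto simp: inscribed_def)
  ultimately have cl: "closed (inscribed V)" by (auto intro!: closed_Int closed_INT)
  obtain M where M: "\<And>x. x \<in> P \<Longrightarrow> norm x \<le> M" using bounded by (auto simp: bounded_iff)
  have "norm z \<le> M + real CARD('n) * (real CARD('n) * (2 * M))" if z: "z \<in> inscribed V" for z
  proof -
    obtain x B where zx: "z = (x, B)" by (cases z)
    have le: "a i \<bullet> x + norm (transpose B *v a i) \<le> 1" if "i \<in> {1..m}" for i
      using z that by (auto simp: inscribed_def zx)
    have "a i \<bullet> x \<le> 1" if "i \<in> {1..m}" for i
      using le [OF that] norm_ge_zero [of "transpose B *v a i"] by linarith
    then have x: "x \<in> P" by (simp add: mem_P)
    have col: "x + B *v axis j 1 \<in> P" for j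
      unfolding mem_P
    proof
      fix i assume i: "i \<in> {1..m}"
      have "a i \<bullet> (B *v axis j 1) = (transpose B *v a i) \<bullet> axis j 1"
        by (simp add: dot_lmul_matrix)
      also have "\<dots> \<le> norm (transpose B *v a i)"
        using norm_cauchy_schwarz [of "transpose B *v a i" "axis j 1"] by simp
      finally show "a i \<bullet> (x + B *v axis j 1) \<le> 1" using le [OF i] by (simp add: inner_add_right)
    qed
    have ent: "\<bar>B $ i $ j\<bar> \<le> 2 * M" for i j
    proof -
      have "norm (B *v axis j 1) \<le> norm (x + B *v axis j 1) + norm x"
        using norm_triangle_ineq4 [of "x + B *v axis j 1" x] by simp
      then have "norm (B *v axis j 1) \<le> 2 * M" using M [OF x] M [OF col [of j]] by linarith
      moreover have "\<bar>(B *v axis j 1) $ i\<bar> \<le> norm (B *v axis j 1)" by (rule component_le_norm_cart)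
      ultimately show ?thesis by (simp add: matrix_vector_mult_basis column_def)
    qed
    have row: "norm (B $ i) \<le> real CARD('n) * (2 * M)" for i
    proof -
      have "norm (B $ i) \<le> (\<Sum>j\<in>UNIV. \<bar>B $ i $ j\<bar>)" by (rule norm_le_l1_cart)
      also have "\<dots> \<le> real CARD('n) * (2 * M)"
        using sum_bounded_above [of UNIV "\<lambda>j. \<bar>B $ i $ j\<bar>" "2 * M"] ent by simp
      finally show ?thesis .
    qed
    have "norm B \<le> (\<Sum>i\<in>UNIV. norm (B $ i))"
      unfolding norm_vec_def by (rule L2_set_le_sum) simp
    also have "\<dots> \<le> real CARD('n) * (real CARD('n) * (2 * M))"
      using sum_bounded_above [of UNIV "\<lambda>i. norm (B $ i)"] row by simp
    finally show ?thesis
      using norm_Pair_le [of x B] M [OF x] by (simp add: zx)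
  qed
  then have "bounded (inscribed V)" unfolding bounded_iff by blast
  with cl show ?thesis by (simp add: compact_eq_bounded_closed)
qed

definition inscribed_shape :: "real^'n^'n \<Rightarrow> real^'n^'n" where
  "inscribed_shape B = matrix_inv (B ** transpose B)"

lemma
  assumes z: "(x, B) \<in> inscribed V" and V: "0 < V"
  shows pos_def_inscribed_shape: "pos_def (inscribed_shape B)"
    and inscribed_ellipsoid_subset: "ellipsoid x (inscribed_shape B) \<subseteq> P"
proof -
  have detB: "det B \<noteq> 0" using assms by (auto simp: inscribed_def)
  have "pos_def (mat 1 :: real^'n^'n)" by (simp add: pos_def_def)
  then have BB: "pos_def (B ** transpose B)"
    using pos_def_congruence [of "mat 1" "transpose B"] detB by simp
  then show E: "pos_def (inscribed_shape B)"
    unfolding inscribed_shape_def by (rule pos_def_matrix_inv)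
  have "a i \<bullet> ((B ** transpose B) *v a i) = (norm (transpose B *v a i))\<^sup>2" for i
    by (simp add: matrix_vector_mul_assoc [symmetric] dot_lmul_matrix [symmetric] power2_norm_eq_inner)
  then show "ellipsoid x (inscribed_shape B) \<subseteq> P"
    unfolding P_def ellipsoid_subset_halfspace_polyhedron [OF E]
    using z by (simp add: inscribed_shape_def matrix_inv_matrix_inv [OF pos_def_det_nz [OF BB]] inscribed_def)
qed

text \<open>The square root of \<open>matrix_inv E\<close> is a suitable factor, and the threshold
  is exactly its determinant.\<close>

lemma ellipsoid_inscribed:
  assumes E: "pos_def E" and sub: "ellipsoid y E \<subseteq> P"
  obtains B where "(y, B) \<in> inscribed (exp (- ln (det E) / 2))" "inscribed_shape B = E"
proof -
  obtain B where B: "pos_def B" and BB: "B ** B = matrix_inv E"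
    using pos_def_sqrt [OF pos_def_matrix_inv [OF E]] .
  note sym = pos_def_symmetric [OF B]
  have nrm: "norm (B *v v) = sqrt (v \<bullet> (matrix_inv E *v v))" for v
    by (simp add: norm_eq_sqrt_inner symmetric_inner [OF sym] BB [symmetric] matrix_vector_mul_assoc)
  have "2 * ln (det B) = ln (det (B ** B))"
    using pos_def_det [OF B] by (simp add: det_mul ln_mult)
  also have "\<dots> = - ln (det E)"
    using pos_def_det [OF E] by (simp add: BB det_matrix_inv ln_div)
  finally have "exp (- ln (det E) / 2) = exp (ln (det B))" by simp
  also have "\<dots> = \<bar>det B\<bar>" using pos_def_det [OF B] by simp
  finally have V: "exp (- ln (det E) / 2) = \<bar>det B\<bar>" .
  have "(y, B) \<in> inscribed (exp (- ln (det E) / 2))"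
    using sub unfolding P_def ellipsoid_subset_halfspace_polyhedron [OF E] V
    by (simp add: inscribed_def sym nrm del: transpose_matrix_vector)
  moreover have "inscribed_shape B = E"
    by (simp add: inscribed_shape_def sym BB matrix_inv_matrix_inv pos_def_det_nz [OF E])
  ultimately show ?thesis by (rule that)
qed

lemma inscribed_antimono: "V \<le> W \<Longrightarrow> inscribed W \<subseteq> inscribed V"
  by (auto simp: inscribed_def)

lemma continuous_on_inscribed_shape:
  assumes "0 < V"
  shows "continuous_on (inscribed V) (\<lambda>z. inscribed_shape (snd z))"
  unfolding inscribed_shape_def
  by (intro continuous_on_matrix_inv continuous_intros) (use assms in \<open>auto simp: inscribed_def det_mul\<close>)

text \<open>Every centre in the compact family is an interior point, so the least slack is attained
  and positive.\<close>

lemma slack_lower_bound: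
  assumes V: "0 < V" and i: "i \<in> {1..m}"
  obtains e where "0 < e" "\<And>z. z \<in> inscribed V \<Longrightarrow> e \<le> slack (fst z) i"
proof (cases "inscribed V = {}")
  case True
  then show ?thesis using that [of 1] by simp
next
  case False
  have "continuous_on (inscribed V) (\<lambda>z. slack (fst z) i)"
    unfolding slack_def by (intro continuous_intros)
  then obtain w where w: "w \<in> inscribed V" "\<And>z. z \<in> inscribed V \<Longrightarrow> slack (fst w) i \<le> slack (fst z) i"
    using continuous_attains_inf [OF compact_inscribed False] by blast
  then have "fst w \<in> interior P"
    using inscribed_ellipsoid(1) [OF pos_def_inscribed_shape [OF _ V] inscribed_ellipsoid_subset [OF _ V]]
    by (metis prod.collapse)
  then show ?thesis using that slack_pos [OF _ i] w by blast
qed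

section \<open>Existence, uniqueness and characterisation of the maximal inscribed ellipsoid\<close>

definition maximal_inscribed :: "real^'n \<Rightarrow> real^'n^'n \<Rightarrow> bool" where
  "maximal_inscribed y E \<longleftrightarrow> pos_def E \<and> ellipsoid y E \<subseteq> P \<and>
    (\<forall>y' E'. pos_def E' \<and> ellipsoid y' E' \<subseteq> P \<longrightarrow> ln (det E) \<le> ln (det E'))"

lemma exists_maximal_inscribed: obtains y E where "maximal_inscribed y E"
proof -
  \<comment> \<open>One polarity step from the origin supplies an inscribed ellipsoid whose volume
    serves as threshold \<open>V\<close>; competitors of smaller volume lose to it, so minimising
    the determinant over a compact family suffices.\<close>
  have z: "0 \<in> interior P" by (simp add: interior_P_iff)
  define E0 where "E0 = next_shape 0"
  define V where "V = exp (- ln (det E0) / 2)"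
  have V: "V > 0" by (simp add: V_def)
  obtain B0 where B0: "(next_center 0, B0) \<in> inscribed V" "inscribed_shape B0 = E0"
    using ellipsoid_inscribed [OF pos_def_next_shape [OF z] next_ellipsoid_subset [OF z]]
    unfolding V_def E0_def by blast
  then have "inscribed V \<noteq> {}" by blast
  have pd: "pos_def (inscribed_shape (snd w))" if "w \<in> inscribed V" for w
    using that pos_def_inscribed_shape [OF _ V, of "fst w" "snd w"] by simp
  have "continuous_on (inscribed V) (\<lambda>w. ln (det (inscribed_shape (snd w))))"
    using pd pos_def_det_nz by (intro continuous_intros continuous_on_inscribed_shape V) auto
  then obtain w where w: "w \<in> inscribed V"
    and wmin: "\<And>w'. w' \<in> inscribed V \<Longrightarrow> ln (det (inscribed_shape (snd w))) \<le> ln (det (inscribed_shape (snd w')))"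
    using continuous_attains_inf [OF compact_inscribed \<open>inscribed V \<noteq> {}\<close>] by blast
  have "ln (det (inscribed_shape (snd w))) \<le> ln (det E')" if E': "pos_def E'" "ellipsoid y' E' \<subseteq> P" for y' E'
  proof (cases "ln (det E') \<le> ln (det E0)")
    case True
    obtain B where B: "(y', B) \<in> inscribed (exp (- ln (det E') / 2))" "inscribed_shape B = E'"
      using ellipsoid_inscribed [OF E'] by blast
    have "V \<le> exp (- ln (det E') / 2)" using True by (simp add: V_def)
    then have "(y', B) \<in> inscribed V" using B inscribed_antimono by blast
    then show ?thesis using wmin [of "(y', B)"] B by simp
  next
    case False
    then show ?thesis using wmin [OF B0(1)] B0(2) by simp
  qed
  then have "maximal_inscribed (fst w) (inscribed_shape (snd w))"
    unfolding maximal_inscribed_def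
    using pd [OF w] inscribed_ellipsoid_subset [OF _ V, of "fst w" "snd w"] w by auto
  then show ?thesis by (rule that)
qed

text \<open>A polarity step from any interior \<open>x\<close> yields an inscribed ellipsoid of
  log-determinant at most \<open>2 * vfun P x\<close>, and maximality bounds that from below. At
  \<open>y\<close> this meets the upper bound for inscribed ellipsoids, so its equality case
  applies.\<close>

lemma
  assumes M: "maximal_inscribed y E"
  shows maximal_inscribed_interior: "y \<in> interior P"
    and maximal_inscribed_vfun_le: "x \<in> interior P \<Longrightarrow> ln (det E) / 2 \<le> vfun P x"
    and maximal_inscribed_vfun: "vfun P y = ln (det E) / 2"
    and maximal_inscribed_cvec: "cvec P y = 0"
    and maximal_inscribed_Qmat: "Qmat P y = matrix_inv E"
proof -
  have E: "pos_def E" and sub: "ellipsoid y E \<subseteq> P"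
    using M by (auto simp: maximal_inscribed_def)
  note ins = inscribed_ellipsoid [OF E sub]
  show y: "y \<in> interior P" by (rule ins)
  show le: "ln (det E) / 2 \<le> vfun P x" if x: "x \<in> interior P" for x
  proof -
    have "ln (det E) \<le> ln (det (next_shape x))"
      using M pos_def_next_shape [OF x] next_ellipsoid_subset [OF x]
      unfolding maximal_inscribed_def by blast
    moreover have "(CARD('n) + 1) * ln (1 - tau P x) \<le> 0"
      using tau_nonneg [OF x] tau_less_1 [OF x] by (intro mult_nonneg_nonpos) auto
    ultimately show ?thesis using ln_det_next_shape [OF x] by linarith
  qed
  show v: "vfun P y = ln (det E) / 2" using le [OF y] ins(2) by simp
  show "cvec P y = 0" "Qmat P y = matrix_inv E" using ins(3) [OF v] by auto
qed

text \<open>Both centres have the same value of \<open>vfun\<close> and \<open>cvec\<close> vanishes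
  at each, so only the quadratic term is left in the gap estimate; it must be zero, whence the
  centres agree.\<close>

lemma maximal_inscribed_unique:
  assumes M: "maximal_inscribed y E" and M': "maximal_inscribed y' E'"
  shows "y' = y" "E' = E"
proof -
  note y = maximal_inscribed_interior [OF M] and y' = maximal_inscribed_interior [OF M']
  \<comment> \<open>The sum dominates each slack ratio, and the leading 1 secures the lower bound on
    \<open>R\<close>.\<close>
  define R where "R = 1 + (\<Sum>i\<in>{1..m}. slack y' i / slack y i)"
  have nn: "0 \<le> slack y' i / slack y i" if "i \<in> {1..m}" for i
    using slack_pos [OF y that] slack_pos [OF y' that] by simp
  have R1: "1 \<le> R" unfolding R_def using sum_nonneg [of "{1..m}", OF nn] by simp
  have "slack y' i \<le> R * slack y i" if i: "i \<in> {1..m}" for i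
  proof -
    have "slack y' i / slack y i \<le> R"
      unfolding R_def using member_le_sum [of i "{1..m}" "\<lambda>i. slack y' i / slack y i"] nn i by force
    then show ?thesis using slack_pos [OF y i] by (simp add: pos_divide_le_eq)
  qed
  from vfun_gap [OF y y' maximal_inscribed_cvec [OF M'] R1 this]
  have gap: "vfun P y - vfun P y' \<le> (CARD('n) + 1) *
      (- ((y' - y) \<bullet> (matrix_inv (Qmat P y) *v (y' - y))) / (2 * R * CARD('n)))"
    by (simp add: maximal_inscribed_cvec [OF M])
  have "vfun P y = vfun P y'"
    using maximal_inscribed_vfun_le [OF M y'] maximal_inscribed_vfun_le [OF M' y]
    by (simp add: maximal_inscribed_vfun [OF M] maximal_inscribed_vfun [OF M'])
  then have "(y' - y) \<bullet> (matrix_inv (Qmat P y) *v (y' - y)) \<le> 0"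
    using gap R1 by (simp add: zero_le_mult_iff zero_le_divide_iff mult_le_0_iff divide_le_0_iff)
  then have "y' - y = 0"
    using pos_def_matrix_inv [OF pos_def_Qmat [OF y]] unfolding pos_def_def by (meson not_less)
  then show yy: "y' = y" by simp
  have E: "pos_def E" "pos_def E'" using M M' by (auto simp: maximal_inscribed_def)
  have "matrix_inv E = matrix_inv E'"
    using maximal_inscribed_Qmat [OF M] maximal_inscribed_Qmat [OF M'] yy by simp
  then have "matrix_inv (matrix_inv E) = matrix_inv (matrix_inv E')" by simp
  then show "E' = E" by (simp add: matrix_inv_matrix_inv pos_def_det_nz E)
qed

lemma MaxIE_eq:
  assumes M: "maximal_inscribed y E"
  shows "MaxIE P = ellipsoid y E" "xstar P = y"
proof -
  have E: "pos_def E" and sub: "ellipsoid y E \<subseteq> P"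
    using M by (auto simp: maximal_inscribed_def)
  show "MaxIE P = ellipsoid y E"
    unfolding MaxIE_def
  proof (rule the_equality)
    show "is_ellipsoid (ellipsoid y E) \<and> ellipsoid y E \<subseteq> P \<and>
        (\<forall>S'. is_ellipsoid S' \<and> S' \<subseteq> P \<longrightarrow> Vol S' \<le> Vol (ellipsoid y E))"
      using M by (auto simp: is_ellipsoid_def maximal_inscribed_def Vol_ellipsoid_le_iff)
    fix S assume S: "is_ellipsoid S \<and> S \<subseteq> P \<and> (\<forall>S'. is_ellipsoid S' \<and> S' \<subseteq> P \<longrightarrow> Vol S' \<le> Vol S)"
    then obtain y' E' where E': "pos_def E'" and S': "S = ellipsoid y' E'" by (auto simp: is_ellipsoid_def)
    have "ln (det E') \<le> ln (det E'')" if "pos_def E''" "ellipsoid y'' E'' \<subseteq> P" for y'' E''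
    proof -
      have "is_ellipsoid (ellipsoid y'' E'')" using that by (auto simp: is_ellipsoid_def)
      then have "Vol (ellipsoid y'' E'') \<le> Vol S" using S that by blast
      then show ?thesis using E' that by (simp add: S' Vol_ellipsoid_le_iff)
    qed
    then have "maximal_inscribed y' E'" using S E' S' by (auto simp: maximal_inscribed_def)
    then show "S = ellipsoid y E" using maximal_inscribed_unique [OF M] S' by simp
  qed
  then show "xstar P = y" by (simp add: xstar_def center_ellipsoid E)
qed

lemma maximal_inscribed_xstar: "maximal_inscribed (xstar P) (matrix_inv (Qmat P (xstar P)))"
proof -
  obtain y E where M: "maximal_inscribed y E" by (rule exists_maximal_inscribed)
  then have "matrix_inv (Qmat P y) = E"
    by (simp add: maximal_inscribed_Qmat matrix_inv_matrix_inv pos_def_det_nz maximal_inscribed_def)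
  then show ?thesis using M MaxIE_eq(2) [OF M] by simp
qed

text \<open>Cauchy-Schwarz and a weighted arithmetic-geometric mean bound the linear term of the gap
  so that its \<open>p\<close> part is absorbed by the quadratic term. What remains is a multiple of
  \<open>tau P x\<close>, which the descent of one step recovers up to the factor
  \<open>\<alpha>\<close>.\<close>

lemma contraction:
  fixes R :: real
  assumes x: "x \<in> interior P" and y: "y \<in> interior P" and cy: "cvec P y = 0"
    and R: "1 \<le> R" "\<And>i. i \<in> {1..m} \<Longrightarrow> slack y i \<le> R * slack x i"
  shows "vfun P (next_center x) - vfun P y \<le> (1 - 1 / (R * CARD('n))) * (vfun P x - vfun P y)"
proof -
  define h where "h = y - x"
  define p where "p = h \<bullet> (matrix_inv (Qmat P x) *v h)"
  define \<alpha> where "\<alpha> = R * CARD('n)"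
  have \<alpha>: "\<alpha> > 0" using R by (simp add: \<alpha>_def)
  define s where "s = p / \<alpha>"
  have p: "p = \<alpha> * s" using \<alpha> by (simp add: s_def)
  note \<tau> = tau_nonneg [OF x]
  have p0: "0 \<le> p" unfolding p_def by (rule pos_def_nonneg [OF pos_def_matrix_inv [OF pos_def_Qmat [OF x]]])
  have "(- (cvec P x \<bullet> h))\<^sup>2 \<le> p * tau P x"
    using pos_def_cauchy_schwarz [OF pos_def_Qmat [OF x], of h "cvec P x"]
    by (simp add: p_def tau_def inner_commute)
  also have "\<dots> \<le> ((\<alpha> * tau P x + s) / 2)\<^sup>2"
  proof -
    have "0 \<le> ((\<alpha> * tau P x - s) / 2)\<^sup>2" by simp
    also have "\<dots> = ((\<alpha> * tau P x + s) / 2)\<^sup>2 - p * tau P x"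
      by (simp add: p power2_eq_square field_simps)
    finally show ?thesis by simp
  qed
  finally have "- (cvec P x \<bullet> h) \<le> (\<alpha> * tau P x + s) / 2"
    by (rule power2_le_imp_le) (use \<alpha> p0 \<tau> in \<open>simp add: s_def\<close>)
  moreover have "p / (2 * \<alpha>) = s / 2" by (simp add: s_def)
  ultimately have "- (cvec P x \<bullet> h) - p / (2 * \<alpha>) \<le> \<alpha> * tau P x / 2"
    by (simp only: add_divide_distrib)
  then have "(CARD('n) + 1) * (- (cvec P x \<bullet> h) - p / (2 * \<alpha>)) \<le> (CARD('n) + 1) * (\<alpha> * tau P x / 2)"
    by (rule mult_left_mono) simp
  moreover have "vfun P x - vfun P y \<le> (CARD('n) + 1) * (- (cvec P x \<bullet> h) - p / (2 * \<alpha>))"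
    using vfun_gap [OF x y cy R] by (simp add: h_def p_def \<alpha>_def mult.assoc)
  ultimately have "vfun P x - vfun P y \<le> (CARD('n) + 1) * (\<alpha> * tau P x / 2)"
    by (rule order_trans [rotated])
  then have "(vfun P x - vfun P y) / \<alpha> \<le> (CARD('n) + 1) / 2 * tau P x"
    using \<alpha> by (simp add: divide_le_eq) (simp add: algebra_simps)
  moreover have "(1 - 1 / \<alpha>) * (vfun P x - vfun P y) = vfun P x - vfun P y - (vfun P x - vfun P y) / \<alpha>"
    by (simp add: left_diff_distrib)
  ultimately show ?thesis
    using vfun_next_center [OF x] unfolding \<alpha>_def by linarith
qed

end

lemma contraction_iterations:
  fixes q \<delta> L :: real
  assumes q: "0 < q" "q < 1" and L: "0 < L" and \<delta>: "0 \<le> \<delta>"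
    and N: "N = nat \<lceil>log_plus (\<delta> / L) / ln (1 / q)\<rceil>"
  shows "q ^ N * \<delta> \<le> L"
proof (cases "\<delta> \<le> L")
  case True
  have "q ^ N * \<delta> \<le> 1 * \<delta>" using q \<delta> by (intro mult_right_mono power_le_one) auto
  then show ?thesis using True by simp
next
  case False
  then have t: "\<delta> / L > 1" using L by simp
  have lq: "ln (1 / q) > 0" using q by simp
  have "ln (\<delta> / L) \<le> log_plus (\<delta> / L)" using t by (simp add: log_plus_def)
  moreover have "log_plus (\<delta> / L) / ln (1 / q) \<le> real N" unfolding N by (rule real_nat_ceiling_ge)
  then have "log_plus (\<delta> / L) \<le> real N * ln (1 / q)" using lq by (simp add: pos_divide_le_eq)
  ultimately have "ln (\<delta> / L) \<le> real N * ln (1 / q)" by linarith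
  then have "ln (q ^ N * (\<delta> / L)) \<le> ln 1"
    using q t by (subst ln_mult_pos) (auto simp: ln_realpow ln_div)
  moreover have "0 < q ^ N * (\<delta> / L)" using q t by (intro mult_pos_pos) auto
  ultimately have "q ^ N * (\<delta> / L) \<le> 1" by (subst (asm) ln_le_cancel_iff) auto
  then show ?thesis using L by (simp add: divide_le_eq)
qed

section \<open>Convergence of the process and the volume guarantee\<close>

theorem theorem1:
  fixes a :: "nat \<Rightarrow> real^'n" and m :: nat and P :: "(real^'n) set" and x0 :: "real^'n"
  assumes P_def: "P = halfspace_polyhedron m a"
    and bounded: "bounded P"
    and full_dim: "aff_dim P = int CARD('n)"
    and x0: "x0 \<in> interior P"
  shows "(\<forall>k. proc_x P x0 k \<in> interior P \<and>
            is_ellipsoid (polar_set (polar_MinCE P (proc_x P x0 k)))) \<and>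
    (\<exists>q. 0 < q \<and> q < 1 \<and>
      (\<forall>k. delta_v P (proc_x P x0 (Suc k)) \<le> q * delta_v P (proc_x P x0 k)) \<and>
      proc_x P x0 \<longlonglongrightarrow> xstar P \<and>
      (\<forall>k. proc_E P x0 (Suc k) =
         (1 - tau P (proc_x P x0 k)) *\<^sub>R
           (matrix_inv (Qmat P (proc_x P x0 k)) - outer (cvec P (proc_x P x0 k)))) \<and>
      (\<lambda>k. proc_E P x0 (Suc k)) \<longlonglongrightarrow> matrix_inv (Qmat P (xstar P)) \<and>
      ellipsoid (xstar P) (matrix_inv (Qmat P (xstar P))) = MaxIE P \<and>
      (\<forall>\<gamma>. 0 < \<gamma> \<and> \<gamma> < 1 \<longrightarrow>
         gamma_maximal P \<gamma> (proc_ell P x0 (N_ex P x0 q \<gamma> + 1)) \<and>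
         Vol (proc_ell P x0 (N_ex P x0 q \<gamma> + 1)) / Vol (MaxIE P) \<ge> \<gamma>))"
proof -
  interpret bounded_polyhedron a m P using P_def bounded by unfold_locales
  define y where "y = xstar P"
  define E where "E = matrix_inv (Qmat P y)"
  define X where "X = proc_x P x0"
  have M: "maximal_inscribed y E" unfolding y_def E_def by (rule maximal_inscribed_xstar)
  note y = maximal_inscribed_interior [OF M] and cy = maximal_inscribed_cvec [OF M]
  have E: "pos_def E" using M by (simp add: maximal_inscribed_def)
  have X0: "X 0 = x0" by (simp add: X_def)
  have step: "X (Suc k) = next_center (X k)" "proc_E P x0 (Suc k) = next_shape (X k)"
    if "X k \<in> interior P" for k
    using polar_polar_MinCE [OF that] pos_def_next_shape [OF that]
    by (simp_all add: X_def center_ellipsoid shape_ellipsoid)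
  have X: "X k \<in> interior P" for k
    by (induction k) (auto simp: X0 x0 step next_center_interior)
  have XS: "X (Suc k) = next_center (X k)" and ES: "proc_E P x0 (Suc k) = next_shape (X k)" for k
    using step [OF X] by auto
  have decr: "vfun P (X k) \<le> vfun P x0" for k
  proof (induction k)
    case (Suc k)
    have "0 \<le> (CARD('n) + 1) / 2 * tau P (X k)" using tau_nonneg [OF X] by simp
    then show ?case using Suc vfun_next_center [OF X, of k] by (simp only: XS)
  qed (simp add: X0)
  have ld: "ln (det (next_shape (X k))) \<le> 2 * vfun P (X k)" for k
  proof -
    have "(CARD('n) + 1) * ln (1 - tau P (X k)) \<le> 0"
      using tau_nonneg [OF X] tau_less_1 [OF X] by (intro mult_nonneg_nonpos) auto
    then show ?thesis using ln_det_next_shape [OF X] by simp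
  qed
  \<comment> \<open>By monotonicity of \<open>vfun\<close> along the process this bounds from below
    the normalised volume of every ellipsoid produced, so one compact family contains them
    all.\<close>
  define V where "V = exp (- vfun P x0)"
  have V: "V > 0" by (simp add: V_def)
  have "\<exists>B. (X (Suc k), B) \<in> inscribed V \<and> inscribed_shape B = next_shape (X k)" for k
  proof -
    obtain B where B: "(next_center (X k), B) \<in> inscribed (exp (- ln (det (next_shape (X k))) / 2))"
      and shape: "inscribed_shape B = next_shape (X k)"
      using ellipsoid_inscribed [OF pos_def_next_shape [OF X] next_ellipsoid_subset [OF X]] by blast
    have "V \<le> exp (- ln (det (next_shape (X k))) / 2)"
      using ld [of k] decr [of k] by (simp add: V_def)
    then have "(X (Suc k), B) \<in> inscribed V"
      using subsetD [OF inscribed_antimono B] by (simp add: XS)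
    then show ?thesis using shape by blast
  qed
  then obtain B where B: "\<And>k. (X (Suc k), B k) \<in> inscribed V"
    and BS: "\<And>k. inscribed_shape (B k) = next_shape (X k)" by metis
  have "\<exists>e>0. \<forall>k. e \<le> slack (X k) i" if i: "i \<in> {1..m}" for i
  proof -
    obtain e where e: "0 < e" "\<And>z. z \<in> inscribed V \<Longrightarrow> e \<le> slack (fst z) i"
      using slack_lower_bound [OF V i] by blast
    \<comment> \<open>The starting point need not be the centre of an ellipsoid in the family, so
      its slack enters separately.\<close>
    have "min e (slack x0 i) \<le> slack (X k) i" for k
      using e(2) [OF B] by (cases k) (auto simp: X0 min_le_iff_disj)
    moreover have "min e (slack x0 i) > 0" using e slack_pos [OF x0 i] by simp
    ultimately show ?thesis by blast
  qed
  then obtain e where e: "\<And>i. i \<in> {1..m} \<Longrightarrow> 0 < e i" "\<And>i k. i \<in> {1..m} \<Longrightarrow> e i \<le> slack (X k) i"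
    by metis
  \<comment> \<open>Starting from 2 instead of 1 keeps \<open>q\<close> positive even in dimension
    one.\<close>
  define R where "R = 2 + (\<Sum>i\<in>{1..m}. slack y i / e i)"
  have nn: "0 \<le> slack y i / e i" if "i \<in> {1..m}" for i
    using slack_pos [OF y that] e(1) [OF that] by simp
  have R2: "2 \<le> R" unfolding R_def using sum_nonneg [of "{1..m}", OF nn] by simp
  have R: "slack y i \<le> R * slack (X k) i" if i: "i \<in> {1..m}" for i k
  proof -
    have "slack y i / e i \<le> R"
      unfolding R_def using member_le_sum [of i "{1..m}" "\<lambda>i. slack y i / e i"] nn i by force
    then have "slack y i \<le> R * e i" using e(1) [OF i] by (simp add: pos_divide_le_eq)
    also have "\<dots> \<le> R * slack (X k) i" using R2 e(2) [OF i] by (intro mult_left_mono) auto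
    finally show ?thesis .
  qed
  define q where "q = 1 - 1 / (R * CARD('n))"
  have "2 * 1 \<le> R * CARD('n)" using R2 by (intro mult_mono) (auto simp: Suc_leI)
  then have q: "0 < q" "q < 1" by (simp_all add: q_def divide_less_eq)
  define \<delta> where "\<delta> = (\<lambda>k. delta_v P (X k))"
  have \<delta>_eq: "\<delta> k = vfun P (X k) - vfun P y" for k
    by (simp add: \<delta>_def delta_v_def y_def)
  have \<delta>_Suc: "\<delta> (Suc k) \<le> q * \<delta> k" for k
    using contraction [OF X y cy _ R] R2 by (simp add: \<delta>_eq XS q_def)
  have v: "vfun P y = ln (det E) / 2" by (rule maximal_inscribed_vfun [OF M])
  have \<delta>0: "0 \<le> \<delta> k" for k
    using maximal_inscribed_vfun_le [OF M X] by (simp add: \<delta>_eq v)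
  have \<delta>_pow: "\<delta> k \<le> q ^ k * \<delta> 0" for k
  proof (induction k)
    case (Suc k)
    have "q * \<delta> k \<le> q * (q ^ k * \<delta> 0)" using Suc q by (intro mult_left_mono) auto
    then show ?case using \<delta>_Suc [of k] by simp
  qed simp
  have "(\<lambda>k. q ^ k * \<delta> 0) \<longlonglongrightarrow> 0"
    using tendsto_mult_left_zero [OF LIMSEQ_realpow_zero] q by simp
  then have \<delta>_lim: "\<delta> \<longlonglongrightarrow> 0"
    by (rule tendsto_sandwich [OF always_eventually always_eventually tendsto_const, rotated 2])
      (use \<delta>0 \<delta>_pow in auto)
  have pd: "pos_def (inscribed_shape (snd w))" if "w \<in> inscribed V" for w
    using that pos_def_inscribed_shape [OF _ V, of "fst w" "snd w"] by simp
  \<comment> \<open>The factors \<open>B k\<close> need not converge, but the centre and shape they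
    determine do: on the compact family, the optimal determinant is reached only by the maximal
    ellipsoid.\<close>
  have "(\<lambda>k. (fst (X (Suc k), B k), inscribed_shape (snd (X (Suc k), B k)))) \<longlonglongrightarrow> (y, E)"
  proof (rule compact_level_tendsto [OF compact_inscribed [of V], where
        f="\<lambda>w. ln (det (inscribed_shape (snd w)))" and M="ln (det E)" and
        g="\<lambda>w. (fst w, inscribed_shape (snd w))" and z="\<lambda>k. (X (Suc k), B k)"])
    show "continuous_on (inscribed V) (\<lambda>w. ln (det (inscribed_shape (snd w))))"
      using pd pos_def_det_nz by (intro continuous_intros continuous_on_inscribed_shape V) auto
    show "continuous_on (inscribed V) (\<lambda>w. (fst w, inscribed_shape (snd w)))"
      by (intro continuous_intros continuous_on_inscribed_shape V)
    show "(fst w, inscribed_shape (snd w)) = (y, E)"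
      if w: "w \<in> inscribed V" and eq: "ln (det (inscribed_shape (snd w))) = ln (det E)" for w
    proof -
      have "maximal_inscribed (fst w) (inscribed_shape (snd w))"
        using M pd [OF w] inscribed_ellipsoid_subset [OF _ V, of "fst w" "snd w"] w
        by (auto simp: maximal_inscribed_def eq)
      then show ?thesis using maximal_inscribed_unique [OF M] by simp
    qed
    show "(X (Suc k), B k) \<in> inscribed V" for k by (rule B)
    have low: "ln (det E) \<le> ln (det (next_shape (X k)))" for k
      using M pos_def_next_shape [OF X] next_ellipsoid_subset [OF X]
      unfolding maximal_inscribed_def by blast
    \<comment> \<open>Upper half of a sandwich: the log-determinant of the next shape lies between
      its optimal value and this sequence.\<close>
    have "(\<lambda>k. ln (det E) + 2 * \<delta> k) \<longlonglongrightarrow> ln (det E)"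
      using tendsto_add [OF tendsto_const tendsto_mult_right_zero [OF \<delta>_lim]] by simp
    then have "(\<lambda>k. ln (det (next_shape (X k)))) \<longlonglongrightarrow> ln (det E)"
      by (rule real_tendsto_sandwich [OF always_eventually always_eventually tendsto_const, rotated 2])
        (use low ld in \<open>simp_all add: \<delta>_eq v\<close>)
    then show "(\<lambda>k. ln (det (inscribed_shape (snd (X (Suc k), B k))))) \<longlonglongrightarrow> ln (det E)"
      by (simp add: BS)
  qed
  then have lim: "(\<lambda>k. (X (Suc k), next_shape (X k))) \<longlonglongrightarrow> (y, E)" by (simp add: BS)
  have X_lim: "X \<longlonglongrightarrow> y" using tendsto_fst [OF lim] by (simp add: filterlim_sequentially_Suc)
  have E_lim: "(\<lambda>k. next_shape (X k)) \<longlonglongrightarrow> E" using tendsto_snd [OF lim] by simp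
  have main: "gamma_maximal P \<gamma> (proc_ell P x0 (N_ex P x0 q \<gamma> + 1)) \<and>
      Vol (proc_ell P x0 (N_ex P x0 q \<gamma> + 1)) / Vol (MaxIE P) \<ge> \<gamma>" if \<gamma>: "0 < \<gamma>" "\<gamma> < 1" for \<gamma>
  proof -
    define N where "N = N_ex P x0 q \<gamma>"
    \<comment> \<open>Ellipsoid number \<open>N + 1\<close> is computed from iterate
      \<open>N\<close>, and its volume is controlled by \<open>\<delta> N\<close>; this accounts for
      the extra iteration.\<close>
    define S where "S = ellipsoid (next_center (X N)) (next_shape (X N))"
    have S: "proc_ell P x0 (N + 1) = S"
      using XS [of N] ES [of N] by (simp add: proc_ell_def S_def X_def)
    have "ln (1 / \<gamma>) > 0" using \<gamma> by simp
    then have "q ^ N * \<delta> 0 \<le> ln (1 / \<gamma>)"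
      using contraction_iterations [OF q, of "ln (1 / \<gamma>)" "\<delta> 0" N] \<delta>0 [of 0]
      by (simp add: N_def N_ex_def \<delta>_def X0)
    then have "\<delta> N \<le> - ln \<gamma>" using \<delta>_pow [of N] \<gamma> by (simp add: ln_div)
    then have "ln (Vol (ellipsoid y E)) + ln \<gamma> \<le> ln (Vol S)"
      using ld [of N] by (simp add: S_def ln_Vol_ellipsoid E pos_def_next_shape X \<delta>_eq v)
    moreover have pos: "Vol (ellipsoid y E) > 0" "Vol S > 0"
      using pos_def_det_nz [OF E] pos_def_det_nz [OF pos_def_next_shape [OF X, of N]]
      by (simp_all add: S_def Vol_ellipsoid E pos_def_next_shape X)
    ultimately have "ln (\<gamma> * Vol (ellipsoid y E)) \<le> ln (Vol S)"
      using \<gamma> by (simp add: ln_mult)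
    then have le: "\<gamma> * Vol (ellipsoid y E) \<le> Vol S"
      using pos \<gamma> by (subst (asm) ln_le_cancel_iff) auto
    moreover have "is_ellipsoid S" using pos_def_next_shape [OF X] by (auto simp: is_ellipsoid_def S_def)
    moreover have "S \<subseteq> P" unfolding S_def by (rule next_ellipsoid_subset [OF X])
    ultimately show ?thesis
      using pos unfolding N_def [symmetric] S MaxIE_eq(1) [OF M]
      by (simp add: gamma_maximal_def MaxIE_eq(1) [OF M] pos_le_divide_eq)
  qed
  have "is_ellipsoid (polar_set (polar_MinCE P (X k)))" for k
    unfolding polar_polar_MinCE [OF X] using pos_def_next_shape [OF X] by (auto simp: is_ellipsoid_def)
  then show ?thesis
    using X q \<delta>_Suc X_lim E_lim main MaxIE_eq(1) [OF M]
    unfolding X_def \<delta>_def ES [unfolded X_def] E_def y_def next_shape_def by blast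
qed

end
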